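(* There is an absolute constant $C \le 17.89$ such that the following holds. Let $\Gamma \subset \mathbb{Z}^d$ be finite with $D = |\Gamma|$, let $T \subset \Gamma$ with $|T| = M$, and let $f(x) = \sum_{k\in T} c_k e^{ik\cdot x} \in \Pi_\Gamma(M)$ be a fixed trigonometric polynomial with Fourier coefficients $c$ supported on $T$. Define its dynamic range by \[ R := \frac{\max_{k\in T}|c_k|}{\min_{k\in T}|c_k|} \] (in particular $c_k \neq 0$ for all $k \in T$, so that $R$ is defined). Let the random sampling points $X = (x_1,\dots,x_N)$ be chosen according to either the continuous or the discrete probability model. If for some $\epsilon > 0$ \[ N \ge C\, M R^2 \log(4D/\epsilon), \] then with probability at least $1-\epsilon$ the Thresholding algorithm, applied to the sample vector $(f(x_j))_{j=1}^N$ with sparsity parameter $M$, recovers the correct support $T$ and, hence, also the coefficients $c$.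
   Context: Let $d\in\mathbb{N}$ and let $\Gamma\subset\mathbb{Z}^d$ be finite with $D=|\Gamma|$. $\Pi_\Gamma(M)$ is the set of all trigonometric polynomials $f(x)=\sum_{k\in\Gamma}c_k e^{ik\cdot x}$, $x\in[0,2\pi]^d$, $c_k\in\mathbb{C}$, whose coefficient vector $c=(c_k)_{k\in\Gamma}$ is supported on some subset of $\Gamma$ of cardinality at most $M$. Probability models for the sampling points $x_1,\dots,x_N$. (1) Continuous model: $x_1,\dots,x_N$ are independent random variables with the uniform distribution on $[0,2\pi]^d$. (2) Discrete model: for some $m\in\mathbb{N}\setminus\{1\}$, $x_1,\dots,x_N$ are independent random variables with the uniform distribution on the finite grid $\frac{2\pi}{m}\mathbb{Z}_m^d=\{0,\frac{2\pi}{m},\dots,\frac{2\pi(m-1)}{m}\}^d$; in this model it is always assumed that $\Gamma\subset\mathbb{Z}_m^d$, i.e. distinct elements of $\Gamma$ are distinct modulo $m$. (In model (2) some sampling points may coincide.) For $k\in\Gamma$ let $\phi_k=(e^{ik\cdot x_1},\dots,e^{ik\cdot x_N})^{\top}\in\mathbb{C}^N$. For $S\subset\Gamma$ let $\mathcal{F}_{SX}$ be the $N\times|S|$ matrix with columns $\phi_k$, $k\in S$. $\langle\cdot,\cdot\rangle$ is the Euclidean scalar product on $\mathbb{C}^N$ and $\|\cdot\|_2$ its norm. $\log$ is the natural logarithm. Thresholding algorithm. Input: sampling set $X$, sampling vector $\mathrm{f}=(f(x_j))_{j=1}^N$, $\Gamma$, and sparsity $M$. Step 1: find the set $S\subset\Gamma$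 of the indices corresponding to the $M$ largest values among $\{|\langle \mathrm{f},\phi_k\rangle|\}_{k\in\Gamma}$. Step 2: compute $d$ minimizing $\|\mathcal{F}_{SX}d-\mathrm{f}\|_2$. Step 3: output the support $S$ and the coefficient vector that equals $d$ on $S$ and is zero elsewhere. *)

theory Defs
  imports "HOL-Probability.Probability" "HOL-Number_Theory.Cong"
begin

(* The dimension d is a natural number (not a type), so that a constant can be quantified
   before it. Vectors in Z^d and R^d are extensional functions on {..<d}; a point
   configuration X = (x_1, ..., x_N) is a function on {..<N}; vectors in C^N are functions
   nat => complex of which only the values below N matter. *)

definition int_vecs :: "nat \<Rightarrow> (nat \<Rightarrow> int) set" where
  "int_vecs d = {..<d} \<rightarrow>\<^sub>E UNIV"

definition wave :: "nat \<Rightarrow> (nat \<Rightarrow> int) \<Rightarrow> (nat \<Rightarrow> real) \<Rightarrow> complex" where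
  "wave d k x = exp (\<i> * complex_of_real (\<Sum>i<d. real_of_int (k i) * x i))"

definition trig_poly ::
  "nat \<Rightarrow> (nat \<Rightarrow> int) set \<Rightarrow> ((nat \<Rightarrow> int) \<Rightarrow> complex) \<Rightarrow> (nat \<Rightarrow> real) \<Rightarrow> complex" where
  "trig_poly d T c x = (\<Sum>k\<in>T. c k * wave d k x)"

definition dynamic_range :: "(nat \<Rightarrow> int) set \<Rightarrow> ((nat \<Rightarrow> int) \<Rightarrow> complex) \<Rightarrow> real" where
  "dynamic_range T c = Max ((\<lambda>k. cmod (c k)) ` T) / Min ((\<lambda>k. cmod (c k)) ` T)"


definition continuous_dist :: "nat \<Rightarrow> (nat \<Rightarrow> real) measure" where
  "continuous_dist d =
     uniform_measure (\<Pi>\<^sub>M i\<in>{..<d}. lborel) ({..<d} \<rightarrow>\<^sub>E {0..2 * pi})"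

definition grid :: "nat \<Rightarrow> nat \<Rightarrow> (nat \<Rightarrow> real) set" where
  "grid d m = {..<d} \<rightarrow>\<^sub>E {2 * pi * real a / real m | a. a < m}"

definition discrete_dist :: "nat \<Rightarrow> nat \<Rightarrow> (nat \<Rightarrow> real) measure" where
  "discrete_dist d m = uniform_count_measure (grid d m)"

definition distinct_mod :: "nat \<Rightarrow> nat \<Rightarrow> (nat \<Rightarrow> int) set \<Rightarrow> bool" where
  "distinct_mod d m \<Gamma> \<longleftrightarrow>
     (\<forall>k\<in>\<Gamma>. \<forall>l\<in>\<Gamma>. (\<forall>i<d. [k i = l i] (mod int m)) \<longrightarrow> k = l)"

(* The law of a single sampling point, in either of the two probability models. *)
definition sampling_dist :: "nat \<Rightarrow> (nat \<Rightarrow> int) set \<Rightarrow> (nat \<Rightarrow> real) measure \<Rightarrow> bool" where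
  "sampling_dist d \<Gamma> \<mu> \<longleftrightarrow>
     \<mu> = continuous_dist d \<or>
     (\<exists>m\<ge>2. distinct_mod d m \<Gamma> \<and> \<mu> = discrete_dist d m)"


definition phi :: "nat \<Rightarrow> (nat \<Rightarrow> nat \<Rightarrow> real) \<Rightarrow> (nat \<Rightarrow> int) \<Rightarrow> nat \<Rightarrow> complex" where
  "phi d X k = (\<lambda>j. wave d k (X j))"

definition scalar_prod :: "nat \<Rightarrow> (nat \<Rightarrow> complex) \<Rightarrow> (nat \<Rightarrow> complex) \<Rightarrow> complex" where
  "scalar_prod N u v = (\<Sum>j<N. u j * cnj (v j))"

definition norm2 :: "nat \<Rightarrow> (nat \<Rightarrow> complex) \<Rightarrow> real" where
  "norm2 N u = L2_set (\<lambda>j. cmod (u j)) {..<N}"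

(* The matrix with columns phi_k, k in S, applied to a coefficient vector b. *)
definition fourier_mat ::
  "nat \<Rightarrow> (nat \<Rightarrow> int) set \<Rightarrow> (nat \<Rightarrow> nat \<Rightarrow> real) \<Rightarrow> ((nat \<Rightarrow> int) \<Rightarrow> complex) \<Rightarrow> nat \<Rightarrow> complex" where
  "fourier_mat d S X b = (\<lambda>j. \<Sum>k\<in>S. b k * phi d X k j)"

(* Neither the choice of the M largest values (ties) nor the least squares minimizer
   (rank deficiency) need be unique, hence a set of possible results at each step. *)
definition largest :: "nat \<Rightarrow> 'a set \<Rightarrow> ('a \<Rightarrow> real) \<Rightarrow> 'a set set" where
  "largest M \<Gamma> g = {S. S \<subseteq> \<Gamma> \<and> card S = M \<and> (\<forall>k\<in>S. \<forall>l\<in>\<Gamma> - S. g l \<le> g k)}"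

(* All outputs (S, b) that the algorithm can produce from the sample vector y. The vectors
   in C^S over which the residual is minimized are represented by their extension by zero. *)
definition thresholding ::
  "nat \<Rightarrow> nat \<Rightarrow> (nat \<Rightarrow> nat \<Rightarrow> real) \<Rightarrow> (nat \<Rightarrow> complex) \<Rightarrow> (nat \<Rightarrow> int) set \<Rightarrow> nat
     \<Rightarrow> ((nat \<Rightarrow> int) set \<times> ((nat \<Rightarrow> int) \<Rightarrow> complex)) set" where
  "thresholding d N X y \<Gamma> M =
     {(S, b). S \<in> largest M \<Gamma> (\<lambda>k. cmod (scalar_prod N y (phi d X k))) \<and>
        is_arg_min (\<lambda>b. norm2 N (\<lambda>j. fourier_mat d S X b j - y j))
          (\<lambda>b. \<forall>k. k \<notin> S \<longrightarrow> b k = 0) b}"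

end

theory Submission
  imports Defs
begin

text \<open>
  With \<open>Z k = (\<Sum>j<N. \<Sum>l\<in>T - {k}. c l * wave l (x j) * cnj (wave k (x j)))\<close>, the inner product of
  the samples with \<open>phi k\<close> is \<open>N * c k + Z k\<close>, so thresholding separates \<open>T\<close> from the rest as
  soon as \<open>cmod (Z k) < N * a / 2\<close> for all \<open>k\<close>, where \<open>a\<close> is the least modulus of a coefficient.
  Each \<open>Z k\<close> is a sum of iid bounded centered variables; an exponential moment bound in the four
  directions \<open>1, -1, \<i>, -\<i>\<close> of the plane fails with probability at most
  \<open>4 * exp (- 0.056 * N / (M * R\<^sup>2))\<close>, and \<open>0.056 * 17.89 > 1\<close>, so that a small part of
  \<open>\<epsilon>\<close> is left over.

  That part pays for the event that the Fourier matrix on \<open>T\<close> is not injective. Let \<open>P n\<close> be the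
  projection onto the orthogonal complement of the first \<open>n\<close> rows. The trace of \<open>P n\<close> drops by one
  whenever the next row \<open>v\<close> is not killed by \<open>P n\<close>, hence by at least \<open>norm (P n v)\<^sup>2 / M\<close>, whose
  mean is \<open>trace (P n) / M\<close> by orthonormality. As in the coupon collector problem the expected trace
  is at most \<open>M * (1 - 1 / M) ^ N\<close>, which bounds the probability that \<open>P N\<close> is nonzero.
\<close>

subsection \<open>Projection onto the orthogonal complement of a sequence of vectors\<close>

text \<open>If \<open>w = 0\<close> (the new vector depends on the earlier ones), then \<open>x / 0 = 0\<close> makes the step
  leave the projection unchanged.\<close>

primrec perp_proj :: "'a set \<Rightarrow> (nat \<Rightarrow> 'a \<Rightarrow> complex) \<Rightarrow> nat \<Rightarrow> 'a \<Rightarrow> 'a \<Rightarrow> complex" where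
  "perp_proj I v 0 = (\<lambda>k l. if k = l then 1 else 0)"
| "perp_proj I v (Suc n) =
     (let w = (\<lambda>k. \<Sum>l\<in>I. perp_proj I v n k l * v n l)
      in (\<lambda>k l. perp_proj I v n k l - w k * cnj (w l) / of_real (\<Sum>i\<in>I. (cmod (w i))\<^sup>2)))"

definition mat_app :: "'a set \<Rightarrow> ('a \<Rightarrow> 'a \<Rightarrow> complex) \<Rightarrow> ('a \<Rightarrow> complex) \<Rightarrow> 'a \<Rightarrow> complex" where
  "mat_app I P b k = (\<Sum>l\<in>I. P k l * b l)"

definition sqnorm :: "'a set \<Rightarrow> ('a \<Rightarrow> complex) \<Rightarrow> real" where
  "sqnorm I b = (\<Sum>i\<in>I. (cmod (b i))\<^sup>2)"

lemma perp_proj_Suc: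
  "perp_proj I v (Suc n) k l = perp_proj I v n k l
     - mat_app I (perp_proj I v n) (v n) k * cnj (mat_app I (perp_proj I v n) (v n) l)
       / of_real (sqnorm I (mat_app I (perp_proj I v n) (v n)))"
  by (simp add: Let_def mat_app_def sqnorm_def)

declare perp_proj.simps(2) [simp del]

lemma of_real_sqnorm: "of_real (sqnorm I b) = (\<Sum>i\<in>I. b i * cnj (b i))"
  by (simp add: sqnorm_def complex_norm_square [symmetric])

lemma sqnorm_eq_0_iff: "finite I \<Longrightarrow> sqnorm I b = 0 \<longleftrightarrow> (\<forall>i\<in>I. b i = 0)"
  by (simp add: sqnorm_def sum_nonneg_eq_0_iff)

lemma sqnorm_nonneg: "0 \<le> sqnorm I b"
  by (simp add: sqnorm_def sum_nonneg)

text \<open>Makes the vector with index \<open>n\<close> a fresh one: changing it leaves the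
  projection built from its predecessors untouched, so one sample can be integrated out while the
  earlier ones stay fixed.\<close>

lemma perp_proj_cong:
  assumes "\<And>j l. j < n \<Longrightarrow> v j l = u j l"
  shows "perp_proj I v n = perp_proj I u n"
  using assms
proof (induction n)
  case (Suc n)
  then have "perp_proj I v n = perp_proj I u n" "v n = u n" by auto
  then show ?case by (intro ext) (simp only: perp_proj_Suc)
qed simp

lemma perp_proj_hermitian: "perp_proj I v n l k = cnj (perp_proj I v n k l)"
proof (induction n arbitrary: k l)
  case (Suc n)
  show ?case
    unfolding perp_proj_Suc Suc.IH[of l k] by (simp add: mult.commute)
qed simp

lemma mat_app_adjoint:
  "(\<Sum>k\<in>I. mat_app I (perp_proj I v n) b k * cnj (a k))
     = (\<Sum>k\<in>I. b k * cnj (mat_app I (perp_proj I v n) a k))"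
proof -
  have "(\<Sum>k\<in>I. mat_app I (perp_proj I v n) b k * cnj (a k))
     = (\<Sum>k\<in>I. \<Sum>l\<in>I. perp_proj I v n k l * b l * cnj (a k))"
    by (simp add: mat_app_def sum_distrib_right)
  also have "\<dots> = (\<Sum>l\<in>I. \<Sum>k\<in>I. perp_proj I v n k l * b l * cnj (a k))"
    by (rule sum.swap)
  also have "\<dots> = (\<Sum>l\<in>I. b l * cnj (mat_app I (perp_proj I v n) a l))"
    unfolding mat_app_def
    by (simp add: sum_distrib_left perp_proj_hermitian [symmetric] mult_ac)
  finally show ?thesis .
qed

text \<open>A Gram-Schmidt step in the direction \<open>w = P (v n)\<close>. The matrix update pairs
  \<open>w\<close> with \<open>b\<close> itself; once \<open>P w = w\<close> is known, this is the
  same as pairing it with \<open>P b\<close>.\<close>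

lemma mat_app_perp_proj_Suc:
  "mat_app I (perp_proj I v (Suc n)) b k = mat_app I (perp_proj I v n) b k
     - mat_app I (perp_proj I v n) (v n) k
       * ((\<Sum>l\<in>I. b l * cnj (mat_app I (perp_proj I v n) (v n) l))
          / of_real (sqnorm I (mat_app I (perp_proj I v n) (v n))))"
proof -
  define w where "w = mat_app I (perp_proj I v n) (v n)"
  have "mat_app I (perp_proj I v (Suc n)) b k
     = (\<Sum>l\<in>I. perp_proj I v n k l * b l - w k * (b l * cnj (w l) / of_real (sqnorm I w)))"
    unfolding mat_app_def perp_proj_Suc w_def by (simp add: algebra_simps)
  also have "\<dots> = mat_app I (perp_proj I v n) b k
        - w k * ((\<Sum>l\<in>I. b l * cnj (w l)) / of_real (sqnorm I w))"
    by (simp add: sum_subtractf mat_app_def sum_distrib_left sum_divide_distrib)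
  finally show ?thesis by (simp add: w_def)
qed

text \<open>By induction \<open>P w = w\<close> for the new direction \<open>w\<close>, and
  self-adjointness gives \<open>P a\<close> and \<open>a\<close> the same component along
  \<open>w\<close>. Hence one update removes that component and a second one finds nothing left to
  remove.\<close>

lemma perp_proj_idem:
  assumes "finite I" and "k \<in> I"
  shows "mat_app I (perp_proj I v n) (mat_app I (perp_proj I v n) b) k
           = mat_app I (perp_proj I v n) b k"
  using assms(2)
proof (induction n arbitrary: b k)
  case 0
  then show ?case using assms(1) by (simp add: mat_app_def if_distrib[of "\<lambda>x. x * _"] cong: if_cong)
next
  case (Suc n)
  define P where "P = perp_proj I v n"
  define w where "w = mat_app I P (v n)"
  define s where "s = (of_real (sqnorm I w) :: complex)"
  define ip where "ip = (\<lambda>a. \<Sum>l\<in>I. a l * cnj (w l))"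
  have step: "mat_app I (perp_proj I v (Suc n)) a k = mat_app I P a k - w k * (ip a / s)" for a k
    by (simp add: mat_app_perp_proj_Suc P_def w_def s_def ip_def)
  have Pw: "mat_app I P w k = w k" if "k \<in> I" for k
    using Suc.IH[OF that] by (simp add: P_def w_def)
  have ipP: "ip (mat_app I P a) = ip a" for a
    unfolding ip_def P_def mat_app_adjoint
    by (rule sum.cong) (use Pw in \<open>auto simp: P_def\<close>)
  have ipw: "ip w = s" by (simp add: ip_def s_def of_real_sqnorm)
  have lin: "mat_app I P (\<lambda>k. a k - w k * t) k = mat_app I P a k - w k * t"
    if "k \<in> I" for a t k
    using Pw[OF that, symmetric]
    by (simp add: mat_app_def sum_subtractf sum_distrib_left right_diff_distrib mult_ac)
  have iplin: "ip (\<lambda>k. a k - w k * t) = ip a - s * t" for a t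
    unfolding ipw[symmetric] by (simp add: ip_def sum_subtractf sum_distrib_left algebra_simps)
  have fun_eq: "mat_app I (perp_proj I v (Suc n)) b = (\<lambda>k. mat_app I P b k - w k * (ip b / s))"
    by (rule ext) (rule step)
  have "mat_app I P (mat_app I P b) k = mat_app I P b k"
    using Suc.IH[OF Suc.prems] by (simp add: P_def)
  \<comment> \<open>For nonzero \<open>s\<close> the numerator vanishes; for \<open>s = 0\<close>
    division by zero gives 0.\<close>
  moreover have "w k * ((ip b - s * (ip b / s)) / s) = 0"
    by (cases "s = 0") simp_all
  ultimately show ?case
    unfolding step fun_eq lin[OF Suc.prems] iplin ipP by (simp add: ipP)
qed

text \<open>Write \<open>P b\<close> as \<open>P (P b)\<close> and move one \<open>P\<close> to the
  other side. For \<open>b = v n\<close> this makes the coefficient of the update equal to 1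
  whenever \<open>P (v n)\<close> is nonzero.\<close>

lemma sum_mat_app_self:
  assumes "finite I"
  shows "(\<Sum>k\<in>I. b k * cnj (mat_app I (perp_proj I v n) b k))
           = of_real (sqnorm I (mat_app I (perp_proj I v n) b))"
proof -
  let ?P = "mat_app I (perp_proj I v n)"
  have "(\<Sum>k\<in>I. b k * cnj (?P b k)) = (\<Sum>k\<in>I. b k * cnj (?P (?P b) k))"
    using assms by (intro sum.cong) (auto simp: perp_proj_idem)
  also have "\<dots> = (\<Sum>k\<in>I. ?P b k * cnj (?P b k))"
    by (rule mat_app_adjoint[symmetric])
  finally show ?thesis by (simp add: of_real_sqnorm)
qed

text \<open>The newest vector loses exactly its projected part \<open>w\<close>. An older one is
  already killed, and the new correction to it vanishes because its pairing with
  \<open>P (v n)\<close> is that of \<open>P (v j) = 0\<close> with \<open>v n\<close>.\<close>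

lemma perp_proj_annihilates:
  assumes "finite I" and "j < n" and "k \<in> I"
  shows "mat_app I (perp_proj I v n) (v j) k = 0"
  using assms(2,3)
proof (induction n arbitrary: k)
  case (Suc n)
  let ?P = "mat_app I (perp_proj I v n)"
  show ?case
  proof (cases "j = n")
    case True
    have "?P (v n) k = 0" if "sqnorm I (?P (v n)) = 0"
      using that Suc.prems(2) sqnorm_eq_0_iff[OF assms(1)] by blast
    then show ?thesis
      unfolding True mat_app_perp_proj_Suc sum_mat_app_self[OF assms(1)] by (cases "sqnorm I (?P (v n)) = 0") simp_all
  next
    case False
    then have j: "j < n" using Suc.prems by simp
    have "(\<Sum>l\<in>I. v j l * cnj (?P (v n) l)) = (\<Sum>l\<in>I. ?P (v j) l * cnj (v n l))"
      by (rule mat_app_adjoint[symmetric])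
    also have "\<dots> = 0" using Suc.IH[OF j] by simp
    finally show ?thesis
      unfolding mat_app_perp_proj_Suc using Suc.IH[OF j Suc.prems(2)] by simp
  qed
qed simp

text \<open>No update subtracts anything from \<open>b\<close>: its pairing with
  \<open>P (v n)\<close> equals that of \<open>P b = b\<close> with \<open>v n\<close>, which is
  0.\<close>

lemma perp_proj_fixes:
  assumes "finite I" and "\<And>j. j < n \<Longrightarrow> (\<Sum>l\<in>I. b l * cnj (v j l)) = 0" and "k \<in> I"
  shows "mat_app I (perp_proj I v n) b k = b k"
  using assms(2,3)
proof (induction n arbitrary: k)
  case 0
  then show ?case using assms(1) by (simp add: mat_app_def if_distrib[of "\<lambda>x. x * _"] cong: if_cong)
next
  case (Suc n)
  let ?P = "mat_app I (perp_proj I v n)"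
  have IH: "?P b k = b k" if "k \<in> I" for k using Suc that by simp
  have "(\<Sum>l\<in>I. b l * cnj (?P (v n) l)) = (\<Sum>l\<in>I. ?P b l * cnj (v n l))"
    by (rule mat_app_adjoint[symmetric])
  also have "\<dots> = 0" using Suc.prems(1)[of n] IH by simp
  finally show ?case unfolding mat_app_perp_proj_Suc using IH[OF Suc.prems(2)] by simp
qed

text \<open>Supplies the coefficients of a least squares solution when the vectors are the columns
  of the Fourier matrix.\<close>

lemma perp_proj_diff_in_span:
  assumes "finite I"
  shows "\<exists>a. \<forall>k\<in>I. mat_app I (perp_proj I v n) b k = b k - (\<Sum>j<n. a j * v j k)"
proof (induction n arbitrary: b)
  case 0
  then show ?case using assms by (simp add: mat_app_def if_distrib[of "\<lambda>x. x * _"] cong: if_cong)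
next
  case (Suc n)
  let ?P = "mat_app I (perp_proj I v n)"
  obtain a where a: "\<forall>k\<in>I. ?P b k = b k - (\<Sum>j<n. a j * v j k)" using Suc by blast
  obtain a' where a': "\<forall>k\<in>I. ?P (v n) k = v n k - (\<Sum>j<n. a' j * v j k)" using Suc by blast
  define t where "t = (\<Sum>l\<in>I. b l * cnj (?P (v n) l)) / of_real (sqnorm I (?P (v n)))"
  show ?case
  \<comment> \<open>The update subtracts \<open>t\<close> times \<open>P (v n)\<close>, which is
    \<open>v n\<close> minus a combination of the earlier vectors with coefficients
    \<open>a'\<close>; those return with the factor \<open>t\<close>.\<close>
  proof (intro exI[of _ "\<lambda>j. if j = n then t else a j - t * a' j"] ballI)
    fix k assume k: "k \<in> I"
    have "mat_app I (perp_proj I v (Suc n)) b k = ?P b k - ?P (v n) k * t"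
      by (simp add: mat_app_perp_proj_Suc t_def)
    also have "\<dots> = b k - ((\<Sum>j<n. (a j - t * a' j) * v j k) + t * v n k)"
      unfolding a[rule_format, OF k] a'[rule_format, OF k]
      by (simp add: algebra_simps sum_subtractf sum_distrib_left)
    finally show "mat_app I (perp_proj I v (Suc n)) b k
        = b k - (\<Sum>j<Suc n. (if j = n then t else a j - t * a' j) * v j k)" by simp
  qed
qed

section \<open>The trace of the projection\<close>

definition proj_trace :: "'a set \<Rightarrow> (nat \<Rightarrow> 'a \<Rightarrow> complex) \<Rightarrow> nat \<Rightarrow> real" where
  "proj_trace I v n = (\<Sum>k\<in>I. Re (perp_proj I v n k k))"

lemma proj_trace_0: "proj_trace I v 0 = real (card I)"
  by (simp add: proj_trace_def)

text \<open>The subtracted rank-one matrix has trace \<open>sqnorm I w / sqnorm I w\<close>, which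
  is 1, or 0 by division by zero if \<open>w\<close> vanishes. Thus the trace counts the dimensions
  not yet reached.\<close>

lemma proj_trace_Suc:
  "proj_trace I v (Suc n) = proj_trace I v n
     - (if sqnorm I (mat_app I (perp_proj I v n) (v n)) = 0 then 0 else 1)"
proof -
  define w where "w = mat_app I (perp_proj I v n) (v n)"
  have "Re (w k * cnj (w k) / of_real s) = (cmod (w k))\<^sup>2 / s" for k s
    by (metis Re_complex_of_real complex_norm_square of_real_divide)
  then have "proj_trace I v (Suc n) = (\<Sum>k\<in>I. Re (perp_proj I v n k k) - (cmod (w k))\<^sup>2 / sqnorm I w)"
    by (simp only: proj_trace_def perp_proj_Suc w_def[symmetric] minus_complex.simps)
  also have "\<dots> = proj_trace I v n - sqnorm I w / sqnorm I w"
    by (simp add: proj_trace_def sum_subtractf sqnorm_def flip: sum_divide_distrib)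
  finally show ?thesis by (simp add: w_def)
qed

lemma proj_trace_Ints: "proj_trace I v n \<in> \<int>"
  by (induction n) (auto simp: proj_trace_0 proj_trace_Suc)

lemma perp_proj_mult:
  assumes "finite I" and "k \<in> I" and "m \<in> I"
  shows "(\<Sum>l\<in>I. perp_proj I v n k l * perp_proj I v n l m) = perp_proj I v n k m"
proof -
  have e: "mat_app I (perp_proj I v n) (\<lambda>i. if i = m then 1 else 0) = (\<lambda>i. perp_proj I v n i m)"
    using assms by (intro ext) (simp add: mat_app_def if_distrib[of "(*) _"] cong: if_cong)
  show ?thesis
    using perp_proj_idem[OF assms(1,2), of v n "\<lambda>i. if i = m then 1 else 0"]
    unfolding e by (simp add: mat_app_def)
qed

text \<open>A hermitian idempotent is the product of itself with its adjoint, so each diagonal entry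
  is the squared norm of its row. In this form Parseval can produce the trace.\<close>

lemma proj_trace_eq_frobenius:
  assumes "finite I"
  shows "proj_trace I v n = (\<Sum>k\<in>I. \<Sum>l\<in>I. (cmod (perp_proj I v n k l))\<^sup>2)"
proof -
  have "Re (perp_proj I v n k k) = (\<Sum>l\<in>I. (cmod (perp_proj I v n k l))\<^sup>2)" if k: "k \<in> I" for k
  proof -
    have "perp_proj I v n k k = (\<Sum>l\<in>I. perp_proj I v n k l * cnj (perp_proj I v n k l))"
      using perp_proj_mult[OF assms k k, of v n, symmetric]
      by (simp add: perp_proj_hermitian [symmetric])
    also have "\<dots> = of_real (\<Sum>l\<in>I. (cmod (perp_proj I v n k l))\<^sup>2)"
      by (simp add: complex_norm_square[symmetric])
    finally show ?thesis by simp
  qed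
  then show ?thesis by (simp add: proj_trace_def)
qed

lemma proj_trace_nonneg: "finite I \<Longrightarrow> 0 \<le> proj_trace I v n"
  by (simp add: proj_trace_eq_frobenius sum_nonneg)

lemma proj_trace_le: "proj_trace I v n \<le> card I"
  by (induction n) (auto simp: proj_trace_0 proj_trace_Suc)

text \<open>A nonzero entry makes the Frobenius norm positive, and the trace is a nonnegative
  integer. The gap up to 1 is what Markov's inequality exploits.\<close>

lemma proj_trace_ge_1:
  assumes "finite I" and "k \<in> I" and "l \<in> I" and "perp_proj I v n k l \<noteq> 0"
  shows "1 \<le> proj_trace I v n"
proof -
  have "proj_trace I v n \<noteq> 0"
    using assms by (auto simp: proj_trace_eq_frobenius sum_nonneg_eq_0_iff sum_nonneg)
  then show ?thesis
    using proj_trace_nonneg[OF assms(1), of v n] proj_trace_Ints[of I v n]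
    by (auto elim!: Ints_cases)
qed

text \<open>The squared norm of \<open>P b\<close> is the real part of the pairing of
  \<open>b\<close> with \<open>P b\<close>. Bounding each term by the mean of the two squares and
  solving for the norm of \<open>P b\<close> gives the contraction.\<close>

lemma sqnorm_mat_app_le:
  assumes "finite I"
  shows "sqnorm I (mat_app I (perp_proj I v n) b) \<le> sqnorm I b"
proof -
  let ?w = "mat_app I (perp_proj I v n) b"
  have "sqnorm I ?w = Re (\<Sum>k\<in>I. b k * cnj (?w k))"
    by (simp add: sum_mat_app_self[OF assms])
  also have "\<dots> \<le> (\<Sum>k\<in>I. ((cmod (b k))\<^sup>2 + (cmod (?w k))\<^sup>2) / 2)"
    unfolding Re_sum
  proof (rule sum_mono)
    fix k
    have "Re (b k * cnj (?w k)) \<le> cmod (b k) * cmod (?w k)"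
      by (metis complex_Re_le_cmod complex_mod_cnj norm_mult)
    also have "\<dots> \<le> ((cmod (b k))\<^sup>2 + (cmod (?w k))\<^sup>2) / 2"
      using sum_squares_bound[of "cmod (b k)" "cmod (?w k)"] by simp
    finally show "Re (b k * cnj (?w k)) \<le> ((cmod (b k))\<^sup>2 + (cmod (?w k))\<^sup>2) / 2" .
  qed
  also have "\<dots> = (sqnorm I b + sqnorm I ?w) / 2"
    by (simp add: sqnorm_def sum.distrib flip: sum_divide_distrib)
  finally show ?thesis by simp
qed

text \<open>The columns of the projection are orthogonal to all vectors \<open>v j\<close>, and
  anything orthogonal to them is fixed by the projection. Injectivity thereby becomes a condition on
  finitely many measurable entries.\<close>

lemma perp_proj_zero_iff_injective:
  assumes "finite I"
  shows "(\<forall>k\<in>I. \<forall>l\<in>I. perp_proj I v n k l = 0) \<longleftrightarrow>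
    (\<forall>b. (\<forall>j<n. (\<Sum>l\<in>I. b l * cnj (v j l)) = 0) \<longrightarrow> (\<forall>l\<in>I. b l = 0))"
proof (intro iffI allI impI ballI)
  fix b l
  assume "\<forall>k\<in>I. \<forall>l\<in>I. perp_proj I v n k l = 0" "\<forall>j<n. (\<Sum>l\<in>I. b l * cnj (v j l)) = 0" "l \<in> I"
  then show "b l = 0"
    using perp_proj_fixes[OF assms, of n b v l] by (simp add: mat_app_def)
next
  fix k l
  assume *: "\<forall>b. (\<forall>j<n. (\<Sum>l\<in>I. b l * cnj (v j l)) = 0) \<longrightarrow> (\<forall>l\<in>I. b l = 0)"
    and kl: "k \<in> I" "l \<in> I"
  have "(\<Sum>i\<in>I. perp_proj I v n i l * cnj (v j i)) = 0" if "j < n" for j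
  proof -
    have "(\<Sum>i\<in>I. perp_proj I v n i l * cnj (v j i)) = cnj (mat_app I (perp_proj I v n) (v j) l)"
      by (simp add: mat_app_def perp_proj_hermitian [symmetric])
    then show ?thesis using perp_proj_annihilates[OF assms that kl(2)] by simp
  qed
  with *[THEN spec, of "\<lambda>i. perp_proj I v n i l"] kl(1)
  show "perp_proj I v n k l = 0" by simp
qed

subsection \<open>Random samples of a unimodular orthonormal system\<close>

text \<open>Taylor expansion with fourth-order remainder: for
  \<open>\<bar>x\<bar> \<le> 3/10\<close> the quadratic, cubic and quartic parts contribute 1/2 +
  1/20 + 9/1600 = 0.555625, rounded up to 139/250.\<close>

lemma exp_le_quadratic:
  fixes x :: real
  assumes "\<bar>x\<bar> \<le> 3/10"
  shows "exp x \<le> 1 + x + 139/250 * x\<^sup>2"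
proof -
  obtain t where t: "\<bar>t\<bar> \<le> \<bar>x\<bar>" "exp x = (\<Sum>m<4. x ^ m / fact m) + exp t / fact 4 * x ^ 4"
    using Maclaurin_exp_le[of x 4] by blast
  have "7/10 \<le> exp (- t)" using exp_ge_add_one_self[of "-t"] t(1) assms by linarith
  then have "exp t \<le> 3/2" by (simp add: exp_minus field_simps)
  then have "exp t / 24 * x ^ 4 \<le> 3/2 / 24 * x ^ 4"
    by (intro mult_right_mono divide_right_mono) auto
  moreover have "x ^ 4 \<le> (3/10)\<^sup>2 * x\<^sup>2"
  proof -
    have "x\<^sup>2 \<le> (3/10)\<^sup>2" using power_mono[OF assms, of 2] by simp
    then have "x\<^sup>2 * x\<^sup>2 \<le> (3/10)\<^sup>2 * x\<^sup>2" by (intro mult_right_mono) auto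
    then show ?thesis by (simp flip: power_add)
  qed
  ultimately have 4: "exp t / 24 * x ^ 4 \<le> 9/1600 * x\<^sup>2" by (simp add: power2_eq_square)
  have "x ^ 3 / 6 \<le> \<bar>x\<bar> * x\<^sup>2 / 6" using mult_right_mono[of x "\<bar>x\<bar>" "x\<^sup>2"] by (simp add: power3_eq_cube power2_eq_square mult.assoc)
  also have "\<dots> \<le> 3/10 * x\<^sup>2 / 6" using assms by (intro divide_right_mono mult_right_mono) auto
  finally have 3: "x ^ 3 / 6 \<le> 1/20 * x\<^sup>2" by simp
  have "exp x = 1 + x + x\<^sup>2 / 2 + x ^ 3 / 6 + exp t / 24 * x ^ 4"
    unfolding t(2) by (simp add: eval_nat_numeral lessThan_Suc)
  then show ?thesis using 3 4 zero_le_power2[of x] by linarith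
qed

text \<open>Markov's inequality for the exponential of the sum, whose mean factors over the product
  measure. In each factor the linear term has mean 0, and \<open>1 + z \<le> exp z\<close> absorbs
  the quadratic one; the limit on \<open>\<theta> * B\<close> keeps the quadratic bound
  applicable.\<close>

lemma chernoff_iid:
  fixes Y :: "'a \<Rightarrow> real" and N :: nat
  assumes "prob_space \<mu>"
    and [measurable]: "Y \<in> borel_measurable \<mu>" and bound: "\<And>x. \<bar>Y x\<bar> \<le> B"
    and mean: "(\<integral>x. Y x \<partial>\<mu>) = 0" and var: "(\<integral>x. (Y x)\<^sup>2 \<partial>\<mu>) \<le> V"
    and lam: "0 < \<theta>" "\<theta> * B \<le> 3/10"
  shows "measure (\<Pi>\<^sub>M j\<in>{..<N}. \<mu>) {X \<in> space (\<Pi>\<^sub>M j\<in>{..<N}. \<mu>). t \<le> (\<Sum>j<N. Y (X j))}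
    \<le> exp (real N * (139/250 * \<theta>\<^sup>2 * V) - \<theta> * t)"
proof -
  interpret prob_space \<mu> by fact
  interpret product_sigma_finite "\<lambda>_::nat. \<mu>" by standard
  let ?P = "\<Pi>\<^sub>M j\<in>{..<N}. \<mu>"
  have small: "\<bar>\<theta> * Y x\<bar> \<le> 3/10" for x
  proof -
    have "\<bar>\<theta> * Y x\<bar> \<le> \<theta> * B" using bound[of x] lam(1) by (simp add: abs_mult)
    then show ?thesis using lam(2) by linarith
  qed
  have iY: "integrable \<mu> Y"
    by (rule integrable_const_bound[where B = B]) (auto simp: bound)
  have iY2: "integrable \<mu> (\<lambda>x. (Y x)\<^sup>2)"
  proof (rule integrable_const_bound[where B = "B\<^sup>2"])
    show "AE x in \<mu>. norm ((Y x)\<^sup>2) \<le> B\<^sup>2"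
      using bound by (auto intro!: AE_I2 power_mono[of "\<bar>Y _\<bar>" B 2, simplified])
  qed simp
  have iE: "integrable \<mu> (\<lambda>x. exp (\<theta> * Y x))"
  proof (rule integrable_const_bound[where B = "exp (3/10)"])
    show "AE x in \<mu>. norm (exp (\<theta> * Y x)) \<le> exp (3/10)"
      using order_trans[OF abs_ge_self small] by (intro AE_I2) simp
  qed simp
  have "(\<integral>x. exp (\<theta> * Y x) \<partial>\<mu>) \<le> (\<integral>x. 1 + \<theta> * Y x + 139/250 * (\<theta> * Y x)\<^sup>2 \<partial>\<mu>)"
    using iY iY2 by (intro integral_mono iE exp_le_quadratic small) (auto simp: power_mult_distrib)
  also have "\<dots> = 1 + 139/250 * \<theta>\<^sup>2 * (\<integral>x. (Y x)\<^sup>2 \<partial>\<mu>)"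
    using iY iY2 mean by (simp add: power_mult_distrib prob_space)
  also have "\<dots> \<le> 1 + 139/250 * \<theta>\<^sup>2 * V"
    using var by (intro add_left_mono mult_left_mono) auto
  also have "\<dots> \<le> exp (139/250 * \<theta>\<^sup>2 * V)" by (rule exp_ge_add_one_self)
  finally have mgf: "(\<integral>x. exp (\<theta> * Y x) \<partial>\<mu>) \<le> exp (139/250 * \<theta>\<^sup>2 * V)" .
  have expsum: "exp (\<theta> * (\<Sum>j<N. Y (X j))) = (\<Prod>j<N. exp (\<theta> * Y (X j)))" for X
    by (simp add: sum_distrib_left exp_sum)
  have iP: "integrable ?P (\<lambda>X. exp (\<theta> * (\<Sum>j<N. Y (X j))))"
    unfolding expsum by (rule product_integrable_prod) (auto intro: iE)
  have "{X \<in> space ?P. t \<le> (\<Sum>j<N. Y (X j))}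
      = {X \<in> space ?P. exp (\<theta> * t) \<le> exp (\<theta> * (\<Sum>j<N. Y (X j)))}"
    using lam(1) by simp
  also have "measure ?P \<dots> \<le> (\<integral>X. exp (\<theta> * (\<Sum>j<N. Y (X j))) \<partial>?P) / exp (\<theta> * t)"
    by (rule integral_Markov_inequality_measure[OF iP]) auto
  also have "(\<integral>X. exp (\<theta> * (\<Sum>j<N. Y (X j))) \<partial>?P) = (\<Prod>j<N. \<integral>x. exp (\<theta> * Y x) \<partial>\<mu>)"
    unfolding expsum by (rule product_integral_prod) (auto intro: iE)
  also have "\<dots> \<le> (\<Prod>j<N. exp (139/250 * \<theta>\<^sup>2 * V))"
    using mgf by (intro prod_mono) auto
  also have "\<dots> = exp (real N * (139/250 * \<theta>\<^sup>2 * V))"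
    by (simp only: prod_constant card_lessThan exp_of_nat_mult)
  finally show ?thesis by (simp add: exp_diff divide_right_mono)
qed

section \<open>Unimodular orthonormal systems and the expected trace\<close>

lemma borel_measurable_cnj [measurable (raw)]:
  "f \<in> borel_measurable M \<Longrightarrow> (\<lambda>x. cnj (f x)) \<in> borel_measurable M"
  by (rule measurable_compose[where g = cnj and N = borel])
     (auto intro!: borel_measurable_continuous_onI continuous_intros)

text \<open>Collects what the two sampling models share, so that every probabilistic estimate is
  proved once for both.\<close>

locale unimodular_system = prob_space \<mu> for \<mu> :: "'a measure" +
  fixes I :: "'k set" and e :: "'k \<Rightarrow> 'a \<Rightarrow> complex"
  assumes finite_I: "finite I"
    and measurable_e: "\<And>k. k \<in> I \<Longrightarrow> e k \<in> borel_measurable \<mu>"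
    and norm_e [simp]: "\<And>k x. cmod (e k x) = 1"
    and orthonormal: "\<And>k l. k \<in> I \<Longrightarrow> l \<in> I \<Longrightarrow>
      (\<integral>x. e k x * cnj (e l x) \<partial>\<mu>) = (if k = l then 1 else 0)"
begin

lemma integrable_e_cnj: "k \<in> I \<Longrightarrow> l \<in> I \<Longrightarrow> integrable \<mu> (\<lambda>x. e k x * cnj (e l x))"
  using measurable_e
  by (intro integrable_const_bound[where B = 1] borel_measurable_times borel_measurable_cnj)
     (auto simp: norm_mult)

lemma parseval:
  assumes "J \<subseteq> I"
  shows "(\<integral>x. (cmod (\<Sum>l\<in>J. b l * e l x))\<^sup>2 \<partial>\<mu>) = (\<Sum>l\<in>J. (cmod (b l))\<^sup>2)"
proof -
  have fin: "finite J" using assms finite_I by (rule finite_subset)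
  have eq: "of_real ((cmod (\<Sum>l\<in>J. b l * e l x))\<^sup>2)
      = (\<Sum>l\<in>J. \<Sum>m\<in>J. (b l * cnj (b m)) * (e l x * cnj (e m x)))" for x
    by (simp add: complex_norm_square sum_product mult_ac del: of_real_power)
  have int: "integrable \<mu> (\<lambda>x. (b l * cnj (b m)) * (e l x * cnj (e m x)))" if "l \<in> J" "m \<in> J" for l m
    using that assms by (intro integrable_mult_right integrable_e_cnj) auto
  have "of_real (\<integral>x. (cmod (\<Sum>l\<in>J. b l * e l x))\<^sup>2 \<partial>\<mu>)
      = (\<integral>x. (\<Sum>l\<in>J. \<Sum>m\<in>J. (b l * cnj (b m)) * (e l x * cnj (e m x))) \<partial>\<mu>)"
    unfolding eq[symmetric] by (rule integral_complex_of_real[symmetric])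
  also have "\<dots> = (\<Sum>l\<in>J. \<integral>x. (\<Sum>m\<in>J. (b l * cnj (b m)) * (e l x * cnj (e m x))) \<partial>\<mu>)"
    by (rule Bochner_Integration.integral_sum) (rule Bochner_Integration.integrable_sum[OF int])
  also have "\<dots> = (\<Sum>l\<in>J. \<Sum>m\<in>J. \<integral>x. (b l * cnj (b m)) * (e l x * cnj (e m x)) \<partial>\<mu>)"
    by (rule sum.cong[OF refl], rule Bochner_Integration.integral_sum, rule int)
  also have "\<dots> = (\<Sum>l\<in>J. \<Sum>m\<in>J. (b l * cnj (b m)) * (if l = m then 1 else 0))"
    using assms orthonormal by (intro sum.cong refl) (simp add: subset_iff)
  also have "\<dots> = (\<Sum>l\<in>J. of_real ((cmod (b l))\<^sup>2))"
    using fin by (simp add: complex_norm_square if_distrib[of "(*) _"] cong: if_cong del: of_real_power)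
  finally show ?thesis by (metis of_real_eq_iff of_real_sum)
qed

lemma measurable_e_comp: "k \<in> I \<Longrightarrow> j < N \<Longrightarrow> (\<lambda>X. e k (X j)) \<in> borel_measurable (\<Pi>\<^sub>M j\<in>{..<N}. \<mu>)"
  by (rule measurable_compose[where f = "\<lambda>X. X j" and g = "e k" and N = \<mu>])
     (auto intro: measurable_e)

text \<open>Conjugated so that orthogonality of \<open>b\<close> to row \<open>j\<close> reads
  \<open>(\<Sum>l\<in>I. b l * e l (X j)) = 0\<close>, the kernel condition of the Fourier
  matrix.\<close>

abbreviation sample_vec :: "(nat \<Rightarrow> 'a) \<Rightarrow> nat \<Rightarrow> 'k \<Rightarrow> complex" where
  "sample_vec X \<equiv> \<lambda>j k. cnj (e k (X j))"

lemma measurable_perp_proj: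
  assumes "J \<subseteq> I" and "n \<le> N" and "k \<in> J" and "l \<in> J"
  shows "(\<lambda>X. perp_proj J (sample_vec X) n k l) \<in> borel_measurable (\<Pi>\<^sub>M j\<in>{..<N}. \<mu>)"
  using assms(2-)
proof (induction n arbitrary: k l)
  case (Suc n)
  have [measurable]: "(\<lambda>X. mat_app J (perp_proj J (sample_vec X) n) (sample_vec X n) k)
      \<in> borel_measurable (\<Pi>\<^sub>M j\<in>{..<N}. \<mu>)" if "k \<in> J" for k
    unfolding mat_app_def
    using Suc that assms(1)
    by (intro borel_measurable_sum borel_measurable_times measurable_e_comp
        borel_measurable_cnj) auto
  note [measurable] = Suc.IH[OF Suc_leD[OF Suc.prems(1)] Suc.prems(2,3)]
  note [measurable] = \<open>k \<in> J\<close> \<open>l \<in> J\<close>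
  show ?case
    unfolding perp_proj_Suc sqnorm_def by measurable
qed simp

lemma measurable_proj_trace:
  assumes "J \<subseteq> I" and "n \<le> N"
  shows "(\<lambda>X. proj_trace J (sample_vec X) n) \<in> borel_measurable (\<Pi>\<^sub>M j\<in>{..<N}. \<mu>)"
  unfolding proj_trace_def using measurable_perp_proj[OF assms]
  by (intro borel_measurable_sum measurable_compose[OF _ borel_measurable_Re]) auto

text \<open>Fubini separates the newest sample from the earlier ones. With those fixed, averaging
  over it shrinks the trace by at least the factor \<open>1 - 1 / card J\<close>.\<close>

lemma expectation_proj_trace:
  assumes "J \<subseteq> I" and "J \<noteq> {}"
  shows "(\<integral>X. proj_trace J (sample_vec X) n \<partial>(\<Pi>\<^sub>M j\<in>{..<n}. \<mu>))
    \<le> real (card J) * (1 - 1 / real (card J)) ^ n"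
proof (induction n)
  case 0
  interpret P: prob_space "\<Pi>\<^sub>M j\<in>{..<0::nat}. \<mu>" by (intro prob_space_PiM prob_space_axioms)
  show ?case by (simp add: proj_trace_0 P.prob_space[simplified])
next
  case (Suc n)
  have fin: "finite J" using assms(1) finite_I by (rule finite_subset)
  then have M: "0 < card J" using assms(2) by (simp add: card_gt_0_iff)
  interpret product_sigma_finite "\<lambda>_::nat. \<mu>" by standard
  interpret P: prob_space "\<Pi>\<^sub>M j\<in>{..<m}. \<mu>" for m :: nat
    by (intro prob_space_PiM prob_space_axioms)
  have int: "integrable (\<Pi>\<^sub>M j\<in>{..<m}. \<mu>) (\<lambda>X. proj_trace J (sample_vec X) m)" for m
    using measurable_proj_trace[OF assms(1) order.refl] proj_trace_nonneg[OF fin] proj_trace_le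
    by (intro P.integrable_const_bound[where B = "card J"] AE_I2) auto
  have inner: "(\<integral>y. proj_trace J (sample_vec (X(n := y))) (Suc n) \<partial>\<mu>)
      \<le> (1 - 1 / card J) * proj_trace J (sample_vec X) n"
    if X: "X \<in> space (\<Pi>\<^sub>M j\<in>{..<n}. \<mu>)" for X
  proof -
    define P where "P = perp_proj J (sample_vec X) n"
    define q where "q = (\<lambda>y. sqnorm J (mat_app J P (\<lambda>k. cnj (e k y))))"
    have P: "perp_proj J (sample_vec (X(n := y))) n = P" for y
      unfolding P_def by (rule perp_proj_cong) simp
    have tr: "proj_trace J (sample_vec (X(n := y))) n = proj_trace J (sample_vec X) n" for y
      using P by (simp add: proj_trace_def P_def)
    \<comment> \<open>Conjugating inside the modulus brings the rows into the form required by
      \<open>parseval\<close>.\<close>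
    have q: "q y = (\<Sum>k\<in>J. (cmod (\<Sum>l\<in>J. cnj (P k l) * e l y))\<^sup>2)" for y
    proof -
      have "cmod (\<Sum>l\<in>J. P k l * cnj (e l y)) = cmod (\<Sum>l\<in>J. cnj (P k l) * e l y)" for k
        by (subst complex_mod_cnj[symmetric]) (simp del: complex_mod_cnj)
      then show ?thesis by (simp add: q_def sqnorm_def mat_app_def)
    qed
    have meas: "(\<lambda>y. \<Sum>l\<in>J. cnj (P k l) * e l y) \<in> borel_measurable \<mu>" for k
      using measurable_e assms(1) by (intro borel_measurable_sum borel_measurable_times) auto
    have q_le: "q y \<le> card J" for y
    proof -
      have "q y \<le> sqnorm J (\<lambda>k. cnj (e k y))"
        unfolding q_def P_def by (rule sqnorm_mat_app_le[OF fin])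
      then show ?thesis by (simp add: sqnorm_def)
    qed
    have q_nonneg: "0 \<le> q y" for y by (simp add: q_def sqnorm_nonneg)
    have iq1: "integrable \<mu> (\<lambda>y. (cmod (\<Sum>l\<in>J. cnj (P k l) * e l y))\<^sup>2)" if "k \<in> J" for k
    proof (rule integrable_const_bound[where B = "card J"])
      show "AE y in \<mu>. norm ((cmod (\<Sum>l\<in>J. cnj (P k l) * e l y))\<^sup>2) \<le> card J"
      proof (rule AE_I2)
        fix y
        have "(cmod (\<Sum>l\<in>J. cnj (P k l) * e l y))\<^sup>2 \<le> q y"
          unfolding q using fin that by (intro member_le_sum) auto
        then show "norm ((cmod (\<Sum>l\<in>J. cnj (P k l) * e l y))\<^sup>2) \<le> card J" using q_le[of y] by simp
      qed
    qed (use meas in simp)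
    have iq: "integrable \<mu> q" unfolding q using iq1 by (intro Bochner_Integration.integrable_sum) auto
    have "(\<integral>y. q y \<partial>\<mu>) = (\<Sum>k\<in>J. \<integral>y. (cmod (\<Sum>l\<in>J. cnj (P k l) * e l y))\<^sup>2 \<partial>\<mu>)"
      unfolding q using iq1 by (rule Bochner_Integration.integral_sum)
    \<comment> \<open>Parseval turns each row into its squared norm, and these add up to the squared
      Frobenius norm, that is, the trace.\<close>
    also have "\<dots> = proj_trace J (sample_vec X) n"
      by (simp add: parseval[OF assms(1)] proj_trace_eq_frobenius[OF fin] P_def)
    finally have Eq: "(\<integral>y. q y \<partial>\<mu>) = proj_trace J (sample_vec X) n" .
    \<comment> \<open>Either \<open>q y = 0\<close> and the trace stays, or it drops by 1, which is
      at least \<open>q y / card J\<close> since projecting a vector of \<open>card J\<close>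
      unimodular entries cannot lengthen it.\<close>
    have step: "proj_trace J (sample_vec (X(n := y))) (Suc n) \<le> proj_trace J (sample_vec X) n - q y / card J" for y
      using q_le[of y] M unfolding proj_trace_Suc P tr by (auto simp: q_def)
    have "(\<integral>y. proj_trace J (sample_vec (X(n := y))) (Suc n) \<partial>\<mu>)
        \<le> (\<integral>y. proj_trace J (sample_vec X) n - q y / card J \<partial>\<mu>)"
    \<comment> \<open>In this form of monotonicity, nonnegativity of the integrable upper function
      takes the place of integrability of the lower one.\<close>
    proof (rule integral_mono_AE')
      show "AE y in \<mu>. 0 \<le> proj_trace J (sample_vec X) n - q y / card J"
      proof (rule AE_I2)
        fix y
        show "0 \<le> proj_trace J (sample_vec X) n - q y / card J"
          using step[of y] proj_trace_nonneg[OF fin, of "sample_vec (X(n := y))" "Suc n"] by linarith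
      qed
    qed (use iq step in auto)
    also have "\<dots> = (1 - 1 / card J) * proj_trace J (sample_vec X) n"
      using iq by (simp add: Eq prob_space algebra_simps)
    finally show ?thesis .
  qed
  have ins: "{..<Suc n} = insert n {..<n}" by auto
  have "(\<integral>X. proj_trace J (sample_vec X) (Suc n) \<partial>(\<Pi>\<^sub>M j\<in>{..<Suc n}. \<mu>))
      = (\<integral>X. \<integral>y. proj_trace J (sample_vec (X(n := y))) (Suc n) \<partial>\<mu> \<partial>(\<Pi>\<^sub>M j\<in>{..<n}. \<mu>))"
    using int[of "Suc n"] unfolding ins by (intro product_integral_insert) auto
  also have "\<dots> \<le> (\<integral>X. (1 - 1 / card J) * proj_trace J (sample_vec X) n \<partial>(\<Pi>\<^sub>M j\<in>{..<n}. \<mu>))"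
  proof (rule integral_mono_AE')
    show "integrable (\<Pi>\<^sub>M j\<in>{..<n}. \<mu>) (\<lambda>X. (1 - 1 / card J) * proj_trace J (sample_vec X) n)"
      using int by simp
  next
    show "AE X in \<Pi>\<^sub>M j\<in>{..<n}. \<mu>. (\<integral>y. proj_trace J (sample_vec (X(n := y))) (Suc n) \<partial>\<mu>)
        \<le> (1 - 1 / card J) * proj_trace J (sample_vec X) n"
      using inner by (intro AE_I2)
  next
    show "AE X in \<Pi>\<^sub>M j\<in>{..<n}. \<mu>. 0 \<le> (1 - 1 / card J) * proj_trace J (sample_vec X) n"
      using proj_trace_nonneg[OF fin] M by (intro AE_I2 mult_nonneg_nonneg) auto
  qed
  also have "\<dots> \<le> (1 - 1 / card J) * (card J * (1 - 1 / card J) ^ n)"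
    using Suc M by (simp add: mult_left_mono)
  finally show ?case by (simp add: mult_ac)
qed

text \<open>Markov's inequality at threshold 1 for the trace, followed by
  \<open>1 - x \<le> exp (- x)\<close> with \<open>x = 1 / card J\<close>.\<close>

lemma prob_perp_proj_nonzero:
  assumes "J \<subseteq> I" and "J \<noteq> {}"
  shows "measure (\<Pi>\<^sub>M j\<in>{..<n}. \<mu>)
      {X \<in> space (\<Pi>\<^sub>M j\<in>{..<n}. \<mu>). \<exists>k\<in>J. \<exists>l\<in>J. perp_proj J (sample_vec X) n k l \<noteq> 0}
    \<le> real (card J) * exp (- real n / real (card J))"
proof -
  let ?P = "\<Pi>\<^sub>M j\<in>{..<n}. \<mu>"
  have fin: "finite J" using assms(1) finite_I by (rule finite_subset)
  then have M: "1 \<le> card J" using assms(2) by (simp add: Suc_le_eq card_gt_0_iff)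
  interpret P: prob_space ?P by (intro prob_space_PiM prob_space_axioms)
  have meas: "(\<lambda>X. proj_trace J (sample_vec X) n) \<in> borel_measurable ?P"
    by (rule measurable_proj_trace[OF assms(1) order.refl])
  have "measure ?P {X \<in> space ?P. \<exists>k\<in>J. \<exists>l\<in>J. perp_proj J (sample_vec X) n k l \<noteq> 0}
      \<le> measure ?P {X \<in> space ?P. 1 \<le> proj_trace J (sample_vec X) n}"
    using meas proj_trace_ge_1[OF fin] by (intro P.finite_measure_mono) auto
  also have "\<dots> \<le> (\<integral>X. proj_trace J (sample_vec X) n \<partial>?P) / 1"
    using meas proj_trace_nonneg[OF fin] proj_trace_le
    by (intro integral_Markov_inequality_measure
        P.integrable_const_bound[where B = "card J"] AE_I2) auto
  also have "\<dots> \<le> real (card J) * (1 - 1 / real (card J)) ^ n"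
    using expectation_proj_trace[OF assms] by simp
  also have "(1 - 1 / real (card J)) ^ n \<le> exp (- 1 / real (card J)) ^ n"
    using M exp_ge_add_one_self[of "- 1 / real (card J)"] by (intro power_mono) auto
  also have "\<dots> = exp (- real n / real (card J))"
    by (simp add: exp_of_nat_mult[symmetric])
  finally show ?thesis by (simp add: mult_left_mono)
qed

end

subsection \<open>Outputs of the thresholding algorithm\<close>

lemma norm2_eq_sqrt_sqnorm: "norm2 N u = sqrt (sqnorm {..<N} u)"
  by (simp add: norm2_def L2_set_def sqnorm_def)

text \<open>Guarantees that every admissible support yields an output, so a competing support cannot
  disappear for lack of a minimizer. Projecting \<open>y\<close> onto the span of the columns gives
  the minimizer.\<close>

lemma least_squares_exists:
  fixes y :: "nat \<Rightarrow> complex"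
  assumes "finite S"
  shows "\<exists>b. is_arg_min (\<lambda>b. norm2 N (\<lambda>j. fourier_mat d S X b j - y j)) (\<lambda>b. \<forall>k. k \<notin> S \<longrightarrow> b k = 0) b"
proof -
  \<comment> \<open>The projection is built from a sequence of vectors, so the columns are
    enumerated; here they lie in the space indexed by \<open>{..<N}\<close>.\<close>
  obtain h where h: "bij_betw h {..<card S} S"
    using assms ex_bij_betw_nat_finite atLeast0LessThan by metis
  define n where "n = card S"
  define v where "v = (\<lambda>i. phi d X (h i))"
  have bij: "bij_betw h {..<n} S" using h by (simp add: n_def)
  have F: "fourier_mat d S X b j = (\<Sum>i<n. b (h i) * v i j)" for b j
    unfolding fourier_mat_def v_def by (rule sum.reindex_bij_betw[OF bij, symmetric])
  define Q where "Q = mat_app {..<N} (perp_proj {..<N} v n)"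
  obtain a where a: "\<forall>j\<in>{..<N}. Q y j = y j - (\<Sum>i<n. a i * v i j)"
    unfolding Q_def using perp_proj_diff_in_span[of "{..<N}" v n y] by auto
  define b0 where "b0 = (\<lambda>k. if k \<in> S then a (inv_into {..<n} h k) else 0)"
  have b0: "b0 (h i) = a i" if "i < n" for i
    using that bij by (simp add: b0_def bij_betw_inv_into_left bij_betwE)
  have res0: "fourier_mat d S X b0 j - y j = - Q y j" if "j < N" for j
    using a that b0 by (simp add: F)
  \<comment> \<open>\<open>Q\<close> kills every column, hence sends all residuals to the same
    vector \<open>- Q y\<close>, which is itself the residual of \<open>b0\<close>; contraction then
    gives minimality.\<close>
  have Qres: "Q (\<lambda>j. fourier_mat d S X b j - y j) j = - Q y j" if "j < N" for b j
  proof -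
    have "Q (\<lambda>j. fourier_mat d S X b j - y j) j = (\<Sum>i<n. b (h i) * Q (v i) j) - Q y j"
      unfolding Q_def mat_app_def F
      by (simp add: right_diff_distrib sum_subtractf sum_distrib_left mult_ac)
         (rule sum.swap)
    also have "(\<Sum>i<n. b (h i) * Q (v i) j) = 0"
      using that by (intro sum.neutral) (simp add: Q_def perp_proj_annihilates)
    finally show ?thesis by simp
  qed
  have "norm2 N (\<lambda>j. fourier_mat d S X b0 j - y j) \<le> norm2 N (\<lambda>j. fourier_mat d S X b j - y j)" for b
  proof -
    have "sqnorm {..<N} (\<lambda>j. fourier_mat d S X b0 j - y j) = sqnorm {..<N} (Q (\<lambda>j. fourier_mat d S X b j - y j))"
      by (simp add: sqnorm_def res0 Qres)
    also have "\<dots> \<le> sqnorm {..<N} (\<lambda>j. fourier_mat d S X b j - y j)"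
      unfolding Q_def by (rule sqnorm_mat_app_le) simp
    finally show ?thesis by (simp add: norm2_eq_sqrt_sqnorm)
  qed
  then have "is_arg_min (\<lambda>b. norm2 N (\<lambda>j. fourier_mat d S X b j - y j)) (\<lambda>b. \<forall>k. k \<notin> S \<longrightarrow> b k = 0) b0"
    by (auto simp: is_arg_min_def b0_def not_less)
  then show ?thesis by blast
qed

text \<open>A tie across the boundary of \<open>T\<close> allows an exchange of two indices and thus
  a second selection. Conversely, a different set of equal cardinality misses an index of
  \<open>T\<close> and contains one outside it, against the strict inequality.\<close>

lemma largest_eq_singleton_iff:
  assumes "finite \<Gamma>" and "T \<subseteq> \<Gamma>"
  shows "largest (card T) \<Gamma> g = {T} \<longleftrightarrow> (\<forall>k\<in>T. \<forall>l\<in>\<Gamma> - T. g l < g k)"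
proof
  assume L: "largest (card T) \<Gamma> g = {T}"
  show "\<forall>k\<in>T. \<forall>l\<in>\<Gamma> - T. g l < g k"
  proof (intro ballI, rule ccontr)
    fix k l
    assume k: "k \<in> T" and l: "l \<in> \<Gamma> - T" and "\<not> g l < g k"
    have le: "g l' \<le> g k'" if "k' \<in> T" "l' \<in> \<Gamma> - T" for k' l'
      using L that by (auto simp: largest_def)
    with k l \<open>\<not> g l < g k\<close> have eq: "g l = g k" by force
    have fin: "finite T" using assms by (rule finite_subset[rotated])
    have "insert l (T - {k}) \<in> largest (card T) \<Gamma> g"
      unfolding largest_def
    proof (intro CollectI conjI ballI)
      have "card (insert l (T - {k})) = Suc (card (T - {k}))"
        using fin l by (intro card_insert_disjoint) auto
      also have "\<dots> = card T" by (rule card.remove[OF fin k, symmetric])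
      finally show "card (insert l (T - {k})) = card T" .
      fix k' l'
      assume "k' \<in> insert l (T - {k})" "l' \<in> \<Gamma> - insert l (T - {k})"
      then show "g l' \<le> g k'"
        using le[of k l'] le[of k' l] le[of k' l'] k l eq by (cases "l' = k"; cases "k' = l") auto
    qed (use assms k l in auto)
    with L l show False by auto
  qed
next
  assume strict: "\<forall>k\<in>T. \<forall>l\<in>\<Gamma> - T. g l < g k"
  have "S = T" if "S \<in> largest (card T) \<Gamma> g" for S
  proof (rule ccontr)
    assume "S \<noteq> T"
    have S: "S \<subseteq> \<Gamma>" "card S = card T" "\<And>k l. k \<in> S \<Longrightarrow> l \<in> \<Gamma> - S \<Longrightarrow> g l \<le> g k"
      using that by (auto simp: largest_def)
    have fin: "finite S" "finite T" using S(1) assms by (auto intro: finite_subset)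
    have "\<not> S \<subseteq> T" "\<not> T \<subseteq> S"
      using card_subset_eq[OF fin(2), of S] card_subset_eq[OF fin(1), of T] S(2) \<open>S \<noteq> T\<close> by auto
    then obtain k l where kl: "k \<in> S" "k \<notin> T" "l \<in> T" "l \<notin> S" by blast
    then have "g k < g l" using strict S(1) by blast
    moreover have "g l \<le> g k" using kl assms(2) by (intro S(3)) auto
    ultimately show False by simp
  qed
  moreover have "T \<in> largest (card T) \<Gamma> g"
    using strict assms by (auto simp: largest_def intro: less_imp_le)
  ultimately show "largest (card T) \<Gamma> g = {T}" by blast
qed

text \<open>An exact characterisation, since the measurability of the success event is derived from
  it as well. The two conditions govern the selection of the support and the uniqueness of the
  coefficients.\<close>

lemma thresholding_eq_singleton_iff:
  fixes X :: "nat \<Rightarrow> nat \<Rightarrow> real" and d :: nat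
  assumes "finite \<Gamma>" and "T \<subseteq> \<Gamma>" and supp: "\<And>k. k \<notin> T \<Longrightarrow> c k = 0"
  defines "y \<equiv> \<lambda>j. trig_poly d T c (X j)"
  shows "thresholding d N X y \<Gamma> (card T) = {(T, c)} \<longleftrightarrow>
    (\<forall>k\<in>T. \<forall>l\<in>\<Gamma> - T. cmod (scalar_prod N y (phi d X l)) < cmod (scalar_prod N y (phi d X k))) \<and>
    (\<forall>b. (\<forall>j<N. (\<Sum>k\<in>T. b k * wave d k (X j)) = 0) \<longrightarrow> (\<forall>k\<in>T. b k = 0))"
    (is "?E \<longleftrightarrow> ?S \<and> ?Inj")
proof -
  define L where "L = largest (card T) \<Gamma> (\<lambda>k. cmod (scalar_prod N y (phi d X k)))"
  define sol where "sol = (\<lambda>S b. is_arg_min (\<lambda>b. norm2 N (\<lambda>j. fourier_mat d S X b j - y j))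
          (\<lambda>b. \<forall>k. k \<notin> S \<longrightarrow> b k = 0) b)"
  have th: "thresholding d N X y \<Gamma> (card T) = {(S, b). S \<in> L \<and> sol S b}"
    by (simp add: thresholding_def L_def sol_def)
  have res: "fourier_mat d T X b j - y j = (\<Sum>k\<in>T. (b k - c k) * wave d k (X j))" for b j
    by (simp add: fourier_mat_def phi_def y_def trig_poly_def sum_subtractf left_diff_distrib)
  have norm0: "norm2 N u = 0 \<longleftrightarrow> (\<forall>j<N. u j = 0)" for u
    by (auto simp: norm2_eq_sqrt_sqnorm sqnorm_eq_0_iff)
  have nonneg: "0 \<le> norm2 N u" for u by (simp add: norm2_eq_sqrt_sqnorm sqnorm_nonneg)
  have c0: "norm2 N (\<lambda>j. fourier_mat d T X c j - y j) = 0" unfolding norm0 res by simp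
  \<comment> \<open>The samples come from a polynomial with frequencies in \<open>T\<close>, so the
    least residual is 0, attained at \<open>c\<close>, and the minimizers are the exact
    interpolants.\<close>
  have sol_T: "sol T b \<longleftrightarrow> (\<forall>k. k \<notin> T \<longrightarrow> b k = 0) \<and> (\<forall>j<N. (\<Sum>k\<in>T. (b k - c k) * wave d k (X j)) = 0)" for b
  proof -
    have "sol T b \<longleftrightarrow> (\<forall>k. k \<notin> T \<longrightarrow> b k = 0) \<and> norm2 N (\<lambda>j. fourier_mat d T X b j - y j) = 0"
      unfolding sol_def is_arg_min_def using c0 nonneg supp by (metis antisym_conv not_less)
    then show ?thesis unfolding norm0 res .
  qed
  have uniq: "(\<forall>b. sol T b \<longleftrightarrow> b = c) \<longleftrightarrow> ?Inj"
  proof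
    assume *: "\<forall>b. sol T b \<longleftrightarrow> b = c"
    show ?Inj
    proof (intro allI impI ballI)
      fix b k
      assume "\<forall>j<N. (\<Sum>k\<in>T. b k * wave d k (X j)) = 0" "k \<in> T"
      then have "sol T (\<lambda>k. if k \<in> T then c k + b k else 0)" unfolding sol_T by simp
      then have "(\<lambda>k. if k \<in> T then c k + b k else 0) = c" using * by blast
      from fun_cong[OF this, of k] show "b k = 0" using \<open>k \<in> T\<close> by simp
    qed
  next
    assume Inj: ?Inj
    show "\<forall>b. sol T b \<longleftrightarrow> b = c"
    proof (intro allI iffI)
      fix b assume b: "sol T b"
      then have "\<forall>k\<in>T. b k - c k = 0"
        using Inj[rule_format, of "\<lambda>k. b k - c k"] unfolding sol_T by auto
      then show "b = c" using b supp unfolding sol_T by (intro ext) (metis eq_iff_diff_eq_0)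
    qed (use supp in \<open>auto simp: sol_T\<close>)
  qed
  have "?E \<longleftrightarrow> L = {T} \<and> (\<forall>b. sol T b \<longleftrightarrow> b = c)"
  proof
    assume E: ?E
    \<comment> \<open>Any other selected support would contribute an output of its own.\<close>
    then have "S = T" if "S \<in> L" for S
    proof -
      have "finite S" using that assms(1) by (auto simp: L_def largest_def intro: finite_subset)
      then obtain b where "sol S b" unfolding sol_def using least_squares_exists by blast
      then show ?thesis using E that unfolding th by blast
    qed
    then show "L = {T} \<and> (\<forall>b. sol T b \<longleftrightarrow> b = c)" using E unfolding th by blast
  qed (auto simp: th)
  then show ?thesis
    unfolding uniq L_def largest_eq_singleton_iff[OF assms(1,2)] .
qed

subsection \<open>Orthonormality of the waves in both sampling models\<close>

lemma wave_eq_prod: "wave d k x = (\<Prod>i<d. exp (\<i> * of_real (of_int (k i) * x i)))"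
  by (simp add: wave_def sum_distrib_left exp_sum)

lemma norm_wave [simp]: "cmod (wave d k x) = 1"
  by (simp add: wave_def)

lemma wave_mult_cnj:
  "wave d k x * cnj (wave d l x) = (\<Prod>i<d. exp (\<i> * of_real (of_int (k i - l i) * x i)))"
  unfolding wave_eq_prod
  by (simp add: exp_cnj flip: prod.distrib exp_add) (simp add: algebra_simps)

lemma has_bochner_integral_exp_period:
  "has_bochner_integral lborel (\<lambda>x. indicator {0..2 * pi} x *\<^sub>R exp (\<i> * of_real (of_int n * x)))
     (if n = 0 then of_real (2 * pi) else (0::complex))"
proof (cases "n = 0")
  case True
  have "has_bochner_integral lborel (\<lambda>x. indicator {0..2 * pi} x *\<^sub>R (1::complex))
      (complex_of_real (2 * pi) - complex_of_real 0)"
    by (rule has_bochner_integral_FTC_Icc) (auto intro!: derivative_eq_intros)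
  then show ?thesis using True by simp
next
  case False
  define F where "F = (\<lambda>x::real. exp (\<i> * of_int n * of_real x) / (\<i> * of_int n))"
  have "has_bochner_integral lborel (\<lambda>x. indicator {0..2 * pi} x *\<^sub>R exp (\<i> * of_int n * of_real x))
      (F (2 * pi) - F 0)"
  proof (rule has_bochner_integral_FTC_Icc)
    fix x :: real
    have "((\<lambda>z. exp (\<i> * of_int n * z) / (\<i> * of_int n)) has_field_derivative
        exp (\<i> * of_int n * of_real x)) (at (of_real x))"
      using False by (auto intro!: derivative_eq_intros)
    then show "(F has_vector_derivative exp (\<i> * of_int n * of_real x)) (at x within {0..2 * pi})"
      unfolding F_def by (rule has_vector_derivative_real_field)
  qed (auto intro!: continuous_intros)
  moreover have "exp (\<i> * of_int n * of_real (2 * pi)) = 1"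
    using exp_integer_2pi[of "of_int n"] by (simp add: mult_ac)
  then have "F (2 * pi) - F 0 = 0" by (simp add: F_def)
  ultimately show ?thesis using False by (simp add: mult.assoc)
qed

text \<open>Both the density and the product of two waves factor over the coordinates; a coordinate
  in which the frequencies differ contributes an integral over full periods, which is 0.\<close>

lemma unimodular_system_continuous:
  assumes "\<Gamma> \<subseteq> int_vecs d" and "finite \<Gamma>"
  shows "unimodular_system (continuous_dist d) \<Gamma> (wave d)"
proof -
  interpret product_sigma_finite "\<lambda>_::nat. lborel :: real measure" by standard
  let ?L = "\<Pi>\<^sub>M i\<in>{..<d}. (lborel :: real measure)"
  let ?A = "{..<d} \<rightarrow>\<^sub>E {0..2 * pi}"
  have em: "emeasure ?L ?A = ennreal ((2 * pi) ^ d)"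
    by (subst emeasure_PiM) (auto simp: ennreal_power)
  have A [measurable]: "?A \<in> sets ?L" by (intro sets_PiM_I_finite) auto
  have meas: "wave d k \<in> borel_measurable ?L" for k
    unfolding wave_def by measurable
  have dens: "continuous_dist d = density ?L (\<lambda>x. ennreal (indicator ?A x / (2 * pi) ^ d))"
    unfolding continuous_dist_def uniform_measure_def em
    by (intro density_cong AE_I2)
       (auto simp: divide_ennreal split: split_indicator simp flip: ennreal_1 simp del: ennreal_1)
  have orth: "(\<integral>x. wave d k x * cnj (wave d l x) \<partial>continuous_dist d) = (if k = l then 1 else 0)"
    if "k \<in> \<Gamma>" "l \<in> \<Gamma>" for k l
  proof -
    define g where "g = (\<lambda>i x. (indicator {0..2 * pi} x :: real) *\<^sub>R exp (\<i> * of_real (of_int (k i - l i) * x)) / of_real (2 * pi))"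
    have g: "has_bochner_integral lborel (g i) (if k i = l i then 1 else 0)" for i
      using has_bochner_integral_divide_zero[OF has_bochner_integral_exp_period[of "k i - l i"], of "of_real (2 * pi)"]
      by (simp add: g_def split: if_splits)
    have "(\<integral>x. wave d k x * cnj (wave d l x) \<partial>continuous_dist d)
        = (\<integral>x. (indicator ?A x / (2 * pi) ^ d) *\<^sub>R (wave d k x * cnj (wave d l x)) \<partial>?L)"
      unfolding dens by (rule integral_density) (use meas in auto)
    also have "\<dots> = (\<integral>x. (\<Prod>i<d. g i (x i)) \<partial>?L)"
    proof (rule Bochner_Integration.integral_cong[OF refl])
      fix x assume "x \<in> space ?L"
      then have "x \<in> ?A \<longleftrightarrow> (\<forall>i<d. x i \<in> {0..2 * pi})"
        by (auto simp: space_PiM PiE_iff)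
      then have ind: "indicator ?A x = (\<Prod>i<d. indicator {0..2 * pi} (x i) :: real)"
        by (auto simp: indicator_def prod_eq_1_iff)
      have "(\<Prod>i<d. g i (x i)) = (\<Prod>i<d. of_real (indicator {0..2 * pi} (x i))) *
          (\<Prod>i<d. exp (\<i> * of_real (of_int (k i - l i) * x i))) / of_real (2 * pi) ^ d"
        by (simp add: g_def scaleR_conv_of_real prod.distrib prod_dividef)
      then show "(indicator ?A x / (2 * pi) ^ d) *\<^sub>R (wave d k x * cnj (wave d l x)) = (\<Prod>i<d. g i (x i))"
        by (simp add: wave_mult_cnj ind scaleR_conv_of_real)
    qed
    also have "\<dots> = (\<Prod>i<d. integral\<^sup>L lborel (g i))"
      using g by (intro product_integral_prod) (auto simp: has_bochner_integral_iff)
    also have "\<dots> = (\<Prod>i<d. if k i = l i then 1 else 0)"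
      using g by (simp add: has_bochner_integral_iff)
    also have "\<dots> = (if k = l then 1 else 0)"
    proof (cases "k = l")
      case False
      have "k \<in> {..<d} \<rightarrow>\<^sub>E UNIV" "l \<in> {..<d} \<rightarrow>\<^sub>E UNIV"
        using that assms(1) by (auto simp: int_vecs_def)
      \<comment> \<open>Both frequencies are extensional, so they can only differ at a coordinate
        below \<open>d\<close>.\<close>
      then have "\<exists>i<d. k i \<noteq> l i"
        using False PiE_ext[of k "{..<d}" "\<lambda>_. UNIV" l] by (metis lessThan_iff)
      then obtain i where "i < d" "k i \<noteq> l i" by blast
      then show ?thesis using False by (auto intro!: prod_zero)
    qed simp
    finally show ?thesis .
  qed
  have prob: "prob_space (continuous_dist d)"
    unfolding continuous_dist_def by (rule prob_space_uniform_measure) (simp_all add: em)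
  show ?thesis
    unfolding unimodular_system_def unimodular_system_axioms_def
    using prob orth assms(2) meas by (auto simp: continuous_dist_def)
qed

text \<open>The sum over the grid factors over the coordinates. Distinctness modulo \<open>m\<close>
  provides a coordinate whose factor is a full geometric sum of an \<open>m\<close>-th root of unity
  other than 1, hence 0.\<close>

lemma unimodular_system_discrete:
  assumes "2 \<le> m" and "distinct_mod d m \<Gamma>" and "finite \<Gamma>"
  shows "unimodular_system (discrete_dist d m) \<Gamma> (wave d)"
proof -
  have B: "{2 * pi * real a / real m | a. a < m} = (\<lambda>a. 2 * pi * real a / real m) ` {..<m}"
    by auto
  have inj: "inj_on (\<lambda>a. 2 * pi * real a / real m) {..<m}"
    using assms(1) by (auto simp: inj_on_def)
  have G: "grid d m = {..<d} \<rightarrow>\<^sub>E (\<lambda>a. 2 * pi * real a / real m) ` {..<m}"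
    by (simp add: grid_def B)
  have fin: "finite (grid d m)" unfolding G by (intro finite_PiE) auto
  have card: "card (grid d m) = m ^ d"
    unfolding G by (simp add: card_PiE card_image[OF inj])
  have prob: "prob_space (discrete_dist d m)"
    unfolding discrete_dist_def using fin card assms(1)
    by (intro prob_space_uniform_count_measure) auto
  have int: "(\<integral>x. f x \<partial>discrete_dist d m) = (\<Sum>x\<in>grid d m. f x) / of_nat (m ^ d)" for f :: "_ \<Rightarrow> complex"
    unfolding discrete_dist_def uniform_count_measure_def using fin
    by (simp add: lebesgue_integral_point_measure_finite card scaleR_conv_of_real sum_divide_distrib)
  have geom: "(\<Sum>b\<in>(\<lambda>a. 2 * pi * real a / real m) ` {..<m}. exp (\<i> * of_real (of_int n * b))) = 0"
    if "\<not> [n = 0] (mod int m)" for n :: int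
  proof -
    define w where "w = exp (\<i> * of_real (2 * pi * of_int n / real m))"
    have "w \<noteq> 1"
    proof
      assume "w = 1"
      then obtain q :: int where "2 * pi * of_int n / real m = of_int (2 * q) * pi"
        by (auto simp: w_def exp_eq_1)
      then have "real_of_int n = of_int (q * int m)" using assms(1) by (simp add: field_simps)
      then have "n = q * int m" by (simp only: of_int_eq_iff)
      then show False using that by (simp add: cong_def)
    qed
    moreover have "w ^ m = 1"
    proof -
      have "w ^ m = exp (of_nat m * (\<i> * of_real (2 * pi * of_int n / real m)))"
        by (simp only: w_def exp_of_nat_mult)
      also have "of_nat m * (\<i> * of_real (2 * pi * of_int n / real m)) = of_real (2 * of_int n * pi) * \<i>"
        using assms(1) by (simp add: field_simps)
      also have "exp \<dots> = 1" by (rule exp_integer_2pi) simp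
      finally show ?thesis .
    qed
    ultimately have "(\<Sum>a<m. w ^ a) = 0" using geometric_sum[of w m] by simp
    moreover have "exp (\<i> * of_real (of_int n * (2 * pi * real a / real m))) = w ^ a" for a
      by (simp add: w_def exp_of_nat_mult[symmetric] mult_ac)
    ultimately show ?thesis by (simp add: sum.reindex[OF inj])
  qed
  have orth: "(\<integral>x. wave d k x * cnj (wave d l x) \<partial>discrete_dist d m) = (if k = l then 1 else 0)"
    if kl: "k \<in> \<Gamma>" "l \<in> \<Gamma>" for k l
  proof (cases "k = l")
    case True
    have "wave d l x * cnj (wave d l x) = 1" for x
      using complex_norm_square[of "wave d l x"] by simp
    then have "(\<Sum>x\<in>grid d m. wave d l x * cnj (wave d l x)) = of_nat (m ^ d)"
      by (simp only: sum_constant card) simp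
    then show ?thesis unfolding int True using assms(1) by simp
  next
    case False
    then obtain i where i: "i < d" "\<not> [k i = l i] (mod int m)"
      using assms(2)[unfolded distinct_mod_def, rule_format, OF kl] by auto
    have "(\<Sum>x\<in>grid d m. wave d k x * cnj (wave d l x))
        = (\<Prod>i<d. \<Sum>b\<in>(\<lambda>a. 2 * pi * real a / real m) ` {..<m}. exp (\<i> * of_real (of_int (k i - l i) * b)))"
      unfolding wave_mult_cnj G by (rule prod_sum_PiE[symmetric]) auto
    also have "\<dots> = 0"
      using i geom[of "k i - l i"] by (intro prod_zero) (auto simp: cong_diff_iff_cong_0)
    finally show ?thesis unfolding int using False by simp
  qed
  have "wave d k \<in> borel_measurable (discrete_dist d m)" for k
    by (simp add: discrete_dist_def measurable_def sets_uniform_count_measure space_uniform_count_measure)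
  then show ?thesis
    unfolding unimodular_system_def unimodular_system_axioms_def
    using prob orth assms(3) by simp
qed

lemma unimodular_system_sampling:
  assumes "\<Gamma> \<subseteq> int_vecs d" and "finite \<Gamma>" and "sampling_dist d \<Gamma> \<mu>"
  shows "unimodular_system \<mu> \<Gamma> (wave d)"
  using assms unimodular_system_continuous unimodular_system_discrete
  unfolding sampling_dist_def by blast

subsection \<open>Failure probabilities\<close>

context unimodular_system
begin

text \<open>The index \<open>k\<close> is left out of the inner sum, so each summand has mean 0. A
  complex number of modulus at least \<open>real N * a / 2\<close> has a real part of size about
  \<open>1 / sqrt 2\<close> times that after one of four rotations, whence the factor 4.\<close>

lemma prob_interference_large:
  fixes c :: "'k \<Rightarrow> complex" and a R :: real and N :: nat
  assumes T: "T \<subseteq> I" "T \<noteq> {}" and k: "k \<in> I" and a: "0 < a" and R: "1 \<le> R"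
    and c: "\<And>l. l \<in> T \<Longrightarrow> cmod (c l) \<le> R * a"
  shows "measure (\<Pi>\<^sub>M j\<in>{..<N}. \<mu>)
      {X \<in> space (\<Pi>\<^sub>M j\<in>{..<N}. \<mu>). real N * a / 2 \<le>
        cmod (\<Sum>j<N. \<Sum>l\<in>T - {k}. c l * (e l (X j) * cnj (e k (X j))))}
    \<le> 4 * exp (- (7/125 * (real N / (real (card T) * R\<^sup>2))))"
proof -
  let ?P = "\<Pi>\<^sub>M j\<in>{..<N}. \<mu>"
  interpret P: prob_space ?P by (intro prob_space_PiM prob_space_axioms)
  have fin: "finite T" using T(1) finite_I by (rule finite_subset)
  define M where "M = real (card T)"
  have M: "0 < M" using T(2) fin by (simp add: M_def card_gt_0_iff)
  define y where "y = (\<lambda>x. \<Sum>l\<in>T - {k}. c l * (e l x * cnj (e k x)))"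
  define Z where "Z = (\<lambda>X. \<Sum>j<N. y (X j))"
  \<comment> \<open>\<open>707/2000\<close> is slightly less than \<open>1 / (2 * sqrt 2)\<close>.\<close>
  define t where "t = 707/2000 * real N * a"
  have int_term: "integrable \<mu> (\<lambda>x. c l * (e l x * cnj (e k x)))" if "l \<in> T - {k}" for l
    using that T k by (intro integrable_mult_right integrable_e_cnj) auto
  have int_y: "integrable \<mu> y"
    unfolding y_def by (rule Bochner_Integration.integrable_sum[OF int_term])
  have [measurable]: "y \<in> borel_measurable \<mu>" using int_y by simp
  have mean_y: "(\<integral>x. y x \<partial>\<mu>) = 0"
  proof -
    have "(\<integral>x. y x \<partial>\<mu>) = (\<Sum>l\<in>T - {k}. \<integral>x. c l * (e l x * cnj (e k x)) \<partial>\<mu>)"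
      unfolding y_def by (rule Bochner_Integration.integral_sum[OF int_term])
    also have "\<dots> = 0"
      using T k by (intro sum.neutral) (auto simp: orthonormal subset_iff)
    finally show ?thesis .
  qed
  have norm_y: "cmod (y x) = cmod (\<Sum>l\<in>T - {k}. c l * e l x)" for x
  proof -
    have "y x = (\<Sum>l\<in>T - {k}. c l * e l x) * cnj (e k x)"
      by (simp add: y_def sum_distrib_right mult.assoc)
    then show ?thesis by (simp add: norm_mult)
  qed
  have bound_y: "cmod (y x) \<le> M * R * a" for x
  proof -
    have "cmod (y x) \<le> (\<Sum>l\<in>T - {k}. cmod (c l))"
      unfolding norm_y by (rule order_trans[OF norm_sum]) (simp add: norm_mult)
    also have "\<dots> \<le> (\<Sum>l\<in>T. cmod (c l))" using fin by (intro sum_mono2) auto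
    also have "\<dots> \<le> (\<Sum>l\<in>T. R * a)" using c by (intro sum_mono)
    finally show ?thesis by (simp add: M_def)
  qed
  have var_y: "(\<integral>x. (cmod (y x))\<^sup>2 \<partial>\<mu>) \<le> M * R\<^sup>2 * a\<^sup>2"
  proof -
    have "(\<integral>x. (cmod (y x))\<^sup>2 \<partial>\<mu>) = (\<Sum>l\<in>T - {k}. (cmod (c l))\<^sup>2)"
      unfolding norm_y using T by (intro parseval) auto
    also have "\<dots> \<le> (\<Sum>l\<in>T. (cmod (c l))\<^sup>2)" using fin by (intro sum_mono2) auto
    also have "\<dots> \<le> (\<Sum>l\<in>T. (R * a)\<^sup>2)" using c by (intro sum_mono power_mono) auto
    finally show ?thesis by (simp add: M_def power_mult_distrib)
  qed
  define A where "A = (\<lambda>u. {X \<in> space ?P. t \<le> (\<Sum>j<N. Re (u * y (X j)))})"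
  have tail: "measure ?P (A u) \<le> exp (- (7/125 * (real N / (M * R\<^sup>2))))" if u: "cmod u = 1" for u
  proof -
    \<comment> \<open>\<open>3/10\<close> is close to the optimal \<open>ln (1 + 1 / (2 * sqrt 2))\<close> of Bennett's bound.\<close>
    define \<theta> where "\<theta> = 3/10 / (M * R\<^sup>2 * a)"
    have Re_le: "\<bar>Re (u * y x)\<bar> \<le> cmod (y x)" for x
      using abs_Re_le_cmod[of "u * y x"] u by (simp add: norm_mult)
    have "measure ?P (A u) \<le> exp (real N * (139/250 * \<theta>\<^sup>2 * (M * R\<^sup>2 * a\<^sup>2)) - \<theta> * t)"
      unfolding A_def
    proof (rule chernoff_iid[OF prob_space_axioms])
      show "\<bar>Re (u * y x)\<bar> \<le> M * R * a" for x
        using Re_le bound_y by (rule order_trans)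
      have "(\<integral>x. Re (u * y x) \<partial>\<mu>) = Re (\<integral>x. u * y x \<partial>\<mu>)"
        using int_y by (intro integral_Re) simp
      then show "(\<integral>x. Re (u * y x) \<partial>\<mu>) = 0" using int_y by (simp add: mean_y)
      have "(\<integral>x. (Re (u * y x))\<^sup>2 \<partial>\<mu>) \<le> (\<integral>x. (cmod (y x))\<^sup>2 \<partial>\<mu>)"
      proof (rule integral_mono_AE')
        show "integrable \<mu> (\<lambda>x. (cmod (y x))\<^sup>2)"
          using bound_y by (intro integrable_const_bound[where B = "(M * R * a)\<^sup>2"])
            (auto intro!: AE_I2 power_mono)
        show "AE x in \<mu>. (Re (u * y x))\<^sup>2 \<le> (cmod (y x))\<^sup>2"
          using Re_le by (intro AE_I2) (simp only: abs_le_square_iff[symmetric] abs_norm_cancel)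
      qed simp
      then show "(\<integral>x. (Re (u * y x))\<^sup>2 \<partial>\<mu>) \<le> M * R\<^sup>2 * a\<^sup>2" using var_y by linarith
      show "0 < \<theta>" using M R a by (simp add: \<theta>_def)
      have "\<theta> * (M * R * a) = 3/10 / R"
        using M R a by (simp add: \<theta>_def power2_eq_square)
      also have "\<dots> \<le> 3/10" using R by (simp add: divide_le_eq)
      finally show "\<theta> * (M * R * a) \<le> 3/10" .
    qed measurable
    \<comment> \<open>The rate is 3/10 * 707/2000 - 139/250 * 9/100 = 0.05601, rounded down to 7/125
      = 0.056.\<close>
    also have "real N * (139/250 * \<theta>\<^sup>2 * (M * R\<^sup>2 * a\<^sup>2)) - \<theta> * t
        = - (5601/100000 * (real N / (M * R\<^sup>2)))"
      using M R a by (simp add: \<theta>_def t_def field_simps power2_eq_square)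
    also have "\<dots> \<le> - (7/125 * (real N / (M * R\<^sup>2)))"
    proof -
      have "0 \<le> real N / (M * R\<^sup>2)" using M by simp
      then show ?thesis by linarith
    qed
    finally show ?thesis by simp
  qed
  let ?U = "{1, - 1, \<i>, - \<i>}"
  have "{X \<in> space ?P. real N * a / 2 \<le> cmod (Z X)} \<subseteq> (\<Union>u\<in>?U. A u)"
  proof
    fix X assume X: "X \<in> {X \<in> space ?P. real N * a / 2 \<le> cmod (Z X)}"
    have A_iff: "X \<in> A u \<longleftrightarrow> t \<le> Re (u * Z X)" for u
      using X by (simp add: A_def Z_def sum_distrib_left Re_sum)
    show "X \<in> (\<Union>u\<in>?U. A u)"
    proof (rule ccontr)
      assume "X \<notin> (\<Union>u\<in>?U. A u)"
      then have less: "\<bar>Re (Z X)\<bar> < t" "\<bar>Im (Z X)\<bar> < t" by (auto simp: A_iff)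
      then have sq: "(Re (Z X))\<^sup>2 < t\<^sup>2" "(Im (Z X))\<^sup>2 < t\<^sup>2"
        using power_strict_mono[OF less(1), of 2] power_strict_mono[OF less(2), of 2] by simp_all
      have "(real N * a / 2)\<^sup>2 \<le> (cmod (Z X))\<^sup>2" using X a by (intro power_mono) auto
      also have "\<dots> < 2 * t\<^sup>2" using sq by (simp add: cmod_power2)
      also have "2 * t\<^sup>2 \<le> (real N * a / 2)\<^sup>2" by (simp add: t_def power_mult_distrib power_divide)
      finally show False by simp
    qed
  qed
  then have "measure ?P {X \<in> space ?P. real N * a / 2 \<le> cmod (Z X)} \<le> measure ?P (\<Union>u\<in>?U. A u)"
    by (intro P.finite_measure_mono) (auto simp: A_def)
  also have "\<dots> \<le> (\<Sum>u\<in>?U. measure ?P (A u))"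
    by (intro P.finite_measure_subadditive_finite) (auto simp: A_def)
  also have "\<dots> \<le> (\<Sum>u\<in>?U. exp (- (7/125 * (real N / (M * R\<^sup>2)))))"
    by (intro sum_mono tail) auto
  also have "\<dots> \<le> 4 * exp (- (7/125 * (real N / (M * R\<^sup>2))))"
    by (simp add: card_insert_if)
  finally show ?thesis by (simp add: Z_def y_def M_def)
qed

end

text \<open>Since 7/125 * 17.89 = 1 + 23/12500, the first term is at most
  \<open>\<epsilon> / (1 + 23/12500)\<close>. The second decays like
  \<open>exp (- 17.89 * L)\<close> with \<open>L = ln (4 * D / \<epsilon>)\<close> and is at most
  \<open>\<epsilon> / 2 ^ 18\<close>, which fits into the remainder.\<close>

lemma failure_prob_le:
  fixes D M N :: nat and R \<epsilon> :: real
  assumes "0 < \<epsilon>" "\<epsilon> < 1" "1 \<le> M" "M \<le> D" "1 \<le> R"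
    and N: "17.89 * real M * R\<^sup>2 * ln (4 * real D / \<epsilon>) \<le> real N"
  shows "real D * (4 * exp (- (7/125 * (real N / (real M * R\<^sup>2))))) + real M * exp (- real N / real M) \<le> \<epsilon>"
proof -
  define L where "L = ln (4 * real D / \<epsilon>)"
  have D: "1 \<le> real D" and M: "1 \<le> real M" and MD: "real M \<le> real D" using assms by auto
  \<comment> \<open>\<open>L \<ge> 1\<close> turns the surplus factors in front of \<open>L\<close>
    into additive gains in the exponents.\<close>
  have "3 \<le> 4 * real D / \<epsilon>" using D assms(1,2) by (simp add: le_divide_eq)
  then have "exp 1 \<le> 4 * real D / \<epsilon>" using exp_le by linarith
  then have L1: "1 \<le> L" unfolding L_def using D assms(1) by (subst ln_ge_iff) auto
  have expL: "exp (- L) = \<epsilon> / (4 * real D)"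
    unfolding L_def using D assms(1) by (simp add: exp_minus)
  have R2: "1 \<le> R\<^sup>2" using assms(5) by (simp add: one_le_power)
  have s: "0 < real M * R\<^sup>2" using M R2 by (intro mult_pos_pos) auto
  have q1: "1789/100 * L \<le> real N / (real M * R\<^sup>2)"
    using N s by (simp add: pos_le_divide_eq L_def mult_ac)
  also have "\<dots> \<le> real N / real M"
    using M R2 mult_pos_pos[OF s, of "real M"] by (intro divide_left_mono) auto
  finally have q2: "1789/100 * L \<le> real N / real M" .
  have "exp (- (23/12500::real)) \<le> 1 / (1 + 23/12500)"
    using exp_ge_add_one_self[of "23/12500::real"] by (simp add: exp_minus field_simps)
  then have "exp (- L) * exp (- (23/12500)) \<le> exp (- L) * (1 / (1 + 23/12500))"
    by (intro mult_left_mono) auto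
  moreover have "exp (- (7/125 * (real N / (real M * R\<^sup>2)))) \<le> exp (- L) * exp (- (23/12500))"
    unfolding exp_add[symmetric] exp_le_cancel_iff using q1 L1 by linarith
  ultimately have "exp (- (7/125 * (real N / (real M * R\<^sup>2)))) \<le> \<epsilon> / (4 * real D) * (1 / (1 + 23/12500))"
    unfolding expL by linarith
  then have "real D * (4 * exp (- (7/125 * (real N / (real M * R\<^sup>2)))))
      \<le> real D * (4 * (\<epsilon> / (4 * real D) * (1 / (1 + 23/12500))))"
    using D by (intro mult_left_mono) auto
  also have "\<dots> = \<epsilon> * (1 / (1 + 23/12500))" using D by simp
  finally have t1: "real D * (4 * exp (- (7/125 * (real N / (real M * R\<^sup>2))))) \<le> \<epsilon> * (1 / (1 + 23/12500))" .
  have "exp (- real N / real M) \<le> exp (- L) * exp (- 16)"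
    unfolding exp_add[symmetric] exp_le_cancel_iff using q2 L1 by (simp add: minus_divide_left[symmetric])
  moreover have "exp (- 16 :: real) \<le> 1 / 2 ^ 16"
  proof -
    have "(2::real) ^ 16 \<le> exp 1 ^ 16" using exp_ge_add_one_self[of "1::real"] by (intro power_mono) auto
    also have "\<dots> = exp 16" by (simp flip: exp_of_nat_mult)
    finally show ?thesis by (simp add: exp_minus field_simps)
  qed
  then have "exp (- L) * exp (- 16) \<le> exp (- L) * (1 / 2 ^ 16)"
    by (intro mult_left_mono) auto
  ultimately have "exp (- real N / real M) \<le> \<epsilon> / (4 * real D) * (1 / 2 ^ 16)"
    unfolding expL by linarith
  then have "real M * exp (- real N / real M) \<le> real D * (\<epsilon> / (4 * real D) * (1 / 2 ^ 16))"
    using MD by (intro mult_mono) auto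
  also have "\<dots> = \<epsilon> * (1 / 2 ^ 18)" using D by simp
  finally have t2: "real M * exp (- real N / real M) \<le> \<epsilon> * (1 / 2 ^ 18)" .
  have "\<epsilon> * (1 / (1 + 23/12500)) + \<epsilon> * (1 / 2 ^ 18) \<le> \<epsilon>" using assms(1) by simp
  then show ?thesis using t1 t2 by linarith
qed

section \<open>Signal and interference; union bound over the frequencies\<close>

lemma scalar_prod_trig_poly:
  assumes "finite T" and "\<And>k. k \<notin> T \<Longrightarrow> c k = 0"
  shows "scalar_prod N (\<lambda>j. trig_poly d T c (X j)) (phi d X k)
    = of_nat N * c k + (\<Sum>j<N. \<Sum>l\<in>T - {k}. c l * (wave d l (X j) * cnj (wave d k (X j))))"
proof -
  have one: "wave d k x * cnj (wave d k x) = 1" for x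
    using complex_norm_square[of "wave d k x"] by simp
  have "trig_poly d T c x * cnj (wave d k x)
      = c k + (\<Sum>l\<in>T - {k}. c l * (wave d l x * cnj (wave d k x)))" for x
  proof -
    have "trig_poly d T c x * cnj (wave d k x) = (\<Sum>l\<in>T. c l * (wave d l x * cnj (wave d k x)))"
      by (simp add: trig_poly_def sum_distrib_right mult.assoc)
    \<comment> \<open>For \<open>k\<close> in \<open>T\<close> the diagonal term has a unimodular
      factor times its conjugate, which is 1; for other \<open>k\<close> the added
      \<open>c k\<close> is 0.\<close>
    also have "\<dots> = c k + (\<Sum>l\<in>T - {k}. c l * (wave d l x * cnj (wave d k x)))"
      using assms(1,2) one by (cases "k \<in> T") (simp_all add: sum.remove)
    finally show ?thesis .
  qed
  then show ?thesis by (simp add: scalar_prod_def phi_def sum.distrib)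
qed

theorem theorem2p3:
  "\<exists>C::real. 0 < C \<and> C \<le> 17.89 \<and>
     (\<forall>(d::nat) (\<Gamma>::(nat \<Rightarrow> int) set) (T::(nat \<Rightarrow> int) set) (c::(nat \<Rightarrow> int) \<Rightarrow> complex)
        (\<mu>::(nat \<Rightarrow> real) measure) (M::nat) (N::nat) (\<epsilon>::real).
        1 \<le> d \<longrightarrow> \<Gamma> \<subseteq> int_vecs d \<longrightarrow> finite \<Gamma> \<longrightarrow>
        T \<subseteq> \<Gamma> \<longrightarrow> T \<noteq> {} \<longrightarrow> card T = M \<longrightarrow>
        (\<forall>k\<in>T. c k \<noteq> 0) \<longrightarrow> (\<forall>k. k \<notin> T \<longrightarrow> c k = 0) \<longrightarrow>
        sampling_dist d \<Gamma> \<mu> \<longrightarrow>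
        0 < \<epsilon> \<longrightarrow>
        real N \<ge> C * real M * (dynamic_range T c)\<^sup>2 * ln (4 * real (card \<Gamma>) / \<epsilon>) \<longrightarrow>
        \<P>(X in \<Pi>\<^sub>M j\<in>{..<N}. \<mu>.
            thresholding d N X (\<lambda>j. trig_poly d T c (X j)) \<Gamma> M = {(T, c)}) \<ge> 1 - \<epsilon>)"
proof (intro exI[of _ "17.89::real"] conjI allI impI)
  fix d :: nat and \<Gamma> T :: "(nat \<Rightarrow> int) set" and c :: "(nat \<Rightarrow> int) \<Rightarrow> complex"
    and \<mu> :: "(nat \<Rightarrow> real) measure" and M N :: nat and \<epsilon> :: real
  assume \<Gamma>: "\<Gamma> \<subseteq> int_vecs d" "finite \<Gamma>" and T: "T \<subseteq> \<Gamma>" "T \<noteq> {}" and M: "card T = M"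
    and c_nz: "\<forall>k\<in>T. c k \<noteq> 0" and supp: "\<forall>k. k \<notin> T \<longrightarrow> c k = 0"
    and \<mu>: "sampling_dist d \<Gamma> \<mu>" and \<epsilon>: "0 < \<epsilon>"
    and N: "17.89 * real M * (dynamic_range T c)\<^sup>2 * ln (4 * real (card \<Gamma>) / \<epsilon>) \<le> real N"
  interpret unimodular_system \<mu> \<Gamma> "wave d"
    using \<Gamma> \<mu> by (rule unimodular_system_sampling)
  let ?P = "\<Pi>\<^sub>M j\<in>{..<N}. \<mu>"
  interpret P: prob_space ?P by (intro prob_space_PiM prob_space_axioms)
  have finT: "finite T" using T(1) \<Gamma>(2) by (rule finite_subset)
  define a where "a = Min ((\<lambda>k. cmod (c k)) ` T)"
  define R where "R = dynamic_range T c"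
  have a: "0 < a" using finT T(2) c_nz by (simp add: a_def)
  have a_le: "a \<le> cmod (c k)" if "k \<in> T" for k using that finT by (simp add: a_def)
  have Ra: "R * a = Max ((\<lambda>k. cmod (c k)) ` T)"
    using a by (simp add: R_def dynamic_range_def a_def)
  have le_Ra: "cmod (c k) \<le> R * a" if "k \<in> T" for k using that finT by (simp add: Ra)
  \<comment> \<open>Any coefficient lies between \<open>a\<close> and \<open>R * a\<close> in
    modulus, which forces \<open>R \<ge> 1\<close>.\<close>
  obtain k0 where "k0 \<in> T" using T(2) by blast
  then have "1 * a \<le> R * a" using a_le[of k0] le_Ra[of k0] by simp
  then have R: "1 \<le> R" using a by (simp only: mult_le_cancel_right_pos)
  define E where "E = {X \<in> space ?P. thresholding d N X (\<lambda>j. trig_poly d T c (X j)) \<Gamma> M = {(T, c)}}"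
  define g where "g = (\<lambda>X k. cmod (scalar_prod N (\<lambda>j. trig_poly d T c (X j)) (phi d X k)))"
  define Z where "Z = (\<lambda>X k. \<Sum>j<N. \<Sum>l\<in>T - {k}. c l * (wave d l (X j) * cnj (wave d k (X j))))"
  have g: "g X k = cmod (of_nat N * c k + Z X k)" for X k
    unfolding g_def Z_def using finT supp by (subst scalar_prod_trig_poly) auto
  have [measurable]: "(\<lambda>X. wave d k (X j)) \<in> borel_measurable ?P" if "k \<in> \<Gamma>" "j < N" for k j
    using measurable_e_comp[OF that] .
  have meas_Z: "(\<lambda>X. Z X k) \<in> borel_measurable ?P" if "k \<in> \<Gamma>" for k
    unfolding Z_def using that T(1)
    by (intro borel_measurable_sum borel_measurable_times borel_measurable_cnj measurable_e_comp) auto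
  have meas_g: "(\<lambda>X. g X k) \<in> borel_measurable ?P" if "k \<in> \<Gamma>" for k
    unfolding g using meas_Z[OF that] by measurable
  define S where "S = {X \<in> space ?P. \<forall>k\<in>T. \<forall>l\<in>\<Gamma> - T. g X l < g X k}"
  define B0 where "B0 = {X \<in> space ?P. \<exists>k\<in>T. \<exists>l\<in>T. perp_proj T (sample_vec X) N k l \<noteq> 0}"
  define B where "B = (\<lambda>k. {X \<in> space ?P. real N * a / 2 \<le> cmod (Z X k)})"
  \<comment> \<open>The conjugates in \<open>sample_vec\<close> cancel those of the orthogonality
    condition, so \<open>B0\<close> is exactly the failure of injectivity on
    \<open>T\<close>.\<close>
  have E_eq: "E = S - B0"
  proof (rule set_eqI)
    fix X
    show "X \<in> E \<longleftrightarrow> X \<in> S - B0"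
      unfolding E_def S_def B0_def g_def M[symmetric]
      using thresholding_eq_singleton_iff[OF \<Gamma>(2) T(1), where c = c and d = d and N = N and X = X] supp
        perp_proj_zero_iff_injective[OF finT, where n = N and v = "sample_vec X"]
      by auto
  qed
  have "S \<in> sets ?P"
    unfolding S_def using meas_g T(1) finT \<Gamma>(2)
    by (intro sets.sets_Collect_finite_All borel_measurable_less finite_Diff) auto
  moreover have meas_B0: "B0 \<in> sets ?P"
    unfolding B0_def using measurable_perp_proj[OF T(1) order.refl] finT
    by (intro sets.sets_Collect_finite_Ex) auto
  ultimately have meas_E: "E \<in> sets ?P" unfolding E_eq by (rule sets.Diff)
  have meas_B: "B k \<in> sets ?P" if "k \<in> \<Gamma>" for k
    unfolding B_def using meas_Z[OF that] by measurable
  have meas_UB: "(\<Union>k\<in>\<Gamma>. B k) \<in> sets ?P"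
    using \<Gamma>(2) meas_B by (rule sets.finite_UN)
  show "1 - \<epsilon> \<le> \<P>(X in ?P. thresholding d N X (\<lambda>j. trig_poly d T c (X j)) \<Gamma> M = {(T, c)})"
  \<comment> \<open>For \<open>\<epsilon> \<ge> 1\<close> the claimed lower bound is not
    positive.\<close>
  proof (cases "\<epsilon> < 1")
    case False
    then show ?thesis by (intro order_trans[OF _ measure_nonneg]) simp
  next
    case True
    have "space ?P - E \<subseteq> (\<Union>k\<in>\<Gamma>. B k) \<union> B0"
    proof
      fix X assume X: "X \<in> space ?P - E"
      show "X \<in> (\<Union>k\<in>\<Gamma>. B k) \<union> B0"
      proof (rule ccontr)
        assume contra: "X \<notin> (\<Union>k\<in>\<Gamma>. B k) \<union> B0"
        then have small: "cmod (Z X k) < real N * a / 2" if "k \<in> \<Gamma>" for k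
          using X that by (auto simp: B_def not_le)
        \<comment> \<open>Off the support only interference remains, below
          \<open>real N * a / 2\<close>; on it at least \<open>real N * a\<close> minus less than
          \<open>real N * a / 2\<close> survives.\<close>
        have "g X l < g X k" if k: "k \<in> T" and l: "l \<in> \<Gamma> - T" for k l
        proof -
          have "g X l = cmod (Z X l)" using l supp by (simp add: g)
          also have "\<dots> < real N * a / 2" using l by (intro small) auto
          also have "\<dots> \<le> real N * cmod (c k) - real N * a / 2"
              using mult_left_mono[OF a_le[OF k], of "real N"] by (simp add: mult.commute)
          also have "\<dots> < real N * cmod (c k) - cmod (Z X k)"
            using small[of k] k T(1) by auto
          also have "\<dots> \<le> g X k"
            unfolding g using norm_diff_ineq[of "of_nat N * c k" "Z X k"] by (simp add: norm_mult)
          finally show ?thesis .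
        qed
        then have "X \<in> E" using X contra by (simp add: E_eq S_def)
        then show False using X by simp
      qed
    qed
    then have "measure ?P (space ?P - E) \<le> measure ?P ((\<Union>k\<in>\<Gamma>. B k) \<union> B0)"
      using meas_UB meas_B0 by (intro P.finite_measure_mono sets.Un)
    also have "\<dots> \<le> measure ?P (\<Union>k\<in>\<Gamma>. B k) + measure ?P B0"
      using meas_UB meas_B0 by (rule measure_Un_le)
    also have "measure ?P (\<Union>k\<in>\<Gamma>. B k) \<le> (\<Sum>k\<in>\<Gamma>. measure ?P (B k))"
      using meas_B \<Gamma>(2) by (intro P.finite_measure_subadditive_finite) auto
    also have "\<dots> \<le> (\<Sum>k\<in>\<Gamma>. 4 * exp (- (7/125 * (real N / (real M * R\<^sup>2)))))"
      unfolding B_def Z_def M[symmetric]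
      using T a R le_Ra by (intro sum_mono prob_interference_large) auto
    also have "measure ?P B0 \<le> real M * exp (- real N / real M)"
      unfolding B0_def M[symmetric] by (rule prob_perp_proj_nonzero[OF T])
    finally have "measure ?P (space ?P - E) \<le> real (card \<Gamma>) * (4 * exp (- (7/125 * (real N / (real M * R\<^sup>2)))))
        + real M * exp (- real N / real M)"
      by simp
    also have "\<dots> \<le> \<epsilon>"
    proof (rule failure_prob_le)
      show "1 \<le> M" using M finT T(2) by (auto simp: Suc_le_eq card_gt_0_iff)
      show "M \<le> card \<Gamma>" using M T(1) \<Gamma>(2) by (auto intro: card_mono)
    qed (use \<epsilon> True R N in \<open>simp_all add: R_def\<close>)
    finally have "1 - measure ?P E \<le> \<epsilon>" using P.prob_compl[OF meas_E] by simp
    then show ?thesis by (simp add: E_def)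
  qed
qed simp_all

end
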